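(* Let $n\ge3$. For every $\varepsilon_0>0$ there exist $u\in W^{1,\frac{n}{n-1}}(B^n,\mathbb{R}^{n+1})$ and $\Omega\in L^n(B^n,\mathfrak{so}(n+1)\otimes\wedge^1)$ such that $$\|\Omega\|_{L^n(B^n)}<\varepsilon_0,\qquad -\Delta u=\Omega\cdot\nabla u\quad\text{in }\mathcal{D}'(B^n),$$ but $u$ is unbounded at the origin (i.e. not essentially bounded on any neighbourhood of $0$), and hence $u$ has no continuous representative.
   Context: $B^n$ is the unit ball in $\mathbb{R}^n$. $\mathfrak{so}(n+1)\otimes\wedge^1$ denotes 1-forms on $\mathbb{R}^n$ with values in the antisymmetric real $(n+1)\times(n+1)$ matrices, so $\Omega=(\Omega_{ij})_{0\le i,j\le n}$ with $\Omega_{ij}=-\Omega_{ji}$. Writing $u=(u^0,\dots,u^n)$, the product is $(\Omega\cdot\nabla u)^i=\sum_{k=0}^n\langle\Omega_{ik},du^k\rangle$. *)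

theory Defs
  imports "HOL-Analysis.Analysis"
begin

definition partial :: "'n::finite \<Rightarrow> (real^'n \<Rightarrow> real) \<Rightarrow> real^'n \<Rightarrow> real" where
  "partial j \<phi> x = frechet_derivative \<phi> (at x) (axis j 1)"

primrec C_k :: "nat \<Rightarrow> (real^'n::finite \<Rightarrow> real) \<Rightarrow> bool" where
  "C_k 0 \<phi> \<longleftrightarrow> continuous_on UNIV \<phi>"
| "C_k (Suc k) \<phi> \<longleftrightarrow> \<phi> differentiable_on UNIV \<and> (\<forall>j. C_k k (partial j \<phi>))"

(* D(U) = C_c^infinity(U); its elements are extended by zero to the whole space. *)
definition test_functions :: "(real^'n::finite) set \<Rightarrow> (real^'n \<Rightarrow> real) set" where
  "test_functions U = {\<phi>. (\<forall>k. C_k k \<phi>) \<and> compact (closure {x. \<phi> x \<noteq> 0})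
                           \<and> closure {x. \<phi> x \<noteq> 0} \<subseteq> U}"

(* A distribution on U is represented by a functional on all functions, of which only the
   values on test_functions U matter. *)
definition regular_distr :: "(real^'n::finite) set \<Rightarrow> (real^'n \<Rightarrow> real) \<Rightarrow> (real^'n \<Rightarrow> real) \<Rightarrow> real" where
  "regular_distr U f \<phi> = (LINT x|lebesgue_on U. f x * \<phi> x)"

definition distr_partial ::
    "'n::finite \<Rightarrow> ((real^'n \<Rightarrow> real) \<Rightarrow> real) \<Rightarrow> (real^'n \<Rightarrow> real) \<Rightarrow> real" where
  "distr_partial j T \<phi> = - T (partial j \<phi>)"

definition distr_laplacian ::
    "((real^'n::finite \<Rightarrow> real) \<Rightarrow> real) \<Rightarrow> (real^'n \<Rightarrow> real) \<Rightarrow> real" where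
  "distr_laplacian T \<phi> = (\<Sum>j\<in>UNIV. distr_partial j (distr_partial j T) \<phi>)"

definition Lp_space :: "real \<Rightarrow> (real^'n::finite) set \<Rightarrow> (real^'n \<Rightarrow> 'b::euclidean_space) set" where
  "Lp_space p U = {f. f \<in> borel_measurable (lebesgue_on U) \<and>
                      integrable (lebesgue_on U) (\<lambda>x. norm (f x) powr p)}"

(* On nested vector types such as real^'n^'m, norm is the Euclidean (Frobenius) norm. *)
definition Lp_norm :: "real \<Rightarrow> (real^'n::finite) set \<Rightarrow> (real^'n \<Rightarrow> 'b::euclidean_space) \<Rightarrow> real" where
  "Lp_norm p U f = (LINT x|lebesgue_on U. norm (f x) powr p) powr (1 / p)"

definition locally_integrable_on ::
    "(real^'n::finite \<Rightarrow> 'b::euclidean_space) \<Rightarrow> (real^'n) set \<Rightarrow> bool"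
    (infix "locally'_integrable'_on" 50) where
  "f locally_integrable_on U \<longleftrightarrow> (\<forall>K. compact K \<and> K \<subseteq> U \<longrightarrow> integrable (lebesgue_on K) f)"

(* The row Du x $ i represents the 1-form du^i at x. Local integrability cannot be dropped,
   since the integral of a non-integrable function is 0 by convention. *)
definition has_weak_gradient ::
    "(real^'n::finite \<Rightarrow> real^'m::finite) \<Rightarrow> (real^'n \<Rightarrow> real^'n^'m) \<Rightarrow> (real^'n) set \<Rightarrow> bool" where
  "has_weak_gradient u Du U \<longleftrightarrow>
     u locally_integrable_on U \<and> Du locally_integrable_on U \<and>
     (\<forall>i j. \<forall>\<phi>\<in>test_functions U.
        distr_partial j (regular_distr U (\<lambda>x. u x $ i)) \<phi> = regular_distr U (\<lambda>x. Du x $ i $ j) \<phi>)"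

definition W1p_space :: "real \<Rightarrow> (real^'n::finite) set \<Rightarrow> (real^'n \<Rightarrow> real^'m::finite) set" where
  "W1p_space p U = {u. u \<in> Lp_space p U \<and> (\<exists>Du. has_weak_gradient u Du U \<and> Du \<in> Lp_space p U)}"

(* so(m)-valued 1-forms: A $ i $ k is a covector, identified with an element of real^'n. *)
definition so_form :: "real^'n::finite^'m::finite^'m \<Rightarrow> bool" where
  "so_form A \<longleftrightarrow> (\<forall>i k. A $ i $ k = - A $ k $ i)"

definition form_dot :: "real^'n::finite^'m::finite^'m \<Rightarrow> real^'n^'m \<Rightarrow> real^'m" where
  "form_dot A G = (\<chi> i. \<Sum>k\<in>UNIV. (A $ i $ k) \<bullet> (G $ k))"

definition ess_bounded_on ::
    "(real^'n::finite \<Rightarrow> 'b::real_normed_vector) \<Rightarrow> (real^'n) set \<Rightarrow> bool" where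
  "ess_bounded_on u V \<longleftrightarrow> (\<exists>C. AE x in lebesgue_on V. norm (u x) \<le> C)"

definition has_continuous_representative ::
    "(real^'n::finite \<Rightarrow> 'b::real_normed_vector) \<Rightarrow> (real^'n) set \<Rightarrow> bool" where
  "has_continuous_representative u U \<longleftrightarrow>
     (\<exists>v. continuous_on U v \<and> (AE x in lebesgue_on U. v x = u x))"

end

theory Submission
  imports Defs "HOL-Real_Asymp.Real_Asymp"
begin

text \<open>
  Write \<open>E p q = |x| powr - p * L powr - q\<close> with \<open>L = \<rho> - ln |x|\<close> and \<open>\<rho>\<close> large (\<open>log_power\<close> below).
  On the unit ball \<open>|x| powr (1 - n)\<close> only just fails to be integrable with exponent \<open>n / (n - 1)\<close>, and
  so does \<open>1 / |x|\<close> with exponent \<open>n\<close>; every quantity in the proof has the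
  critical power of \<open>|x|\<close>, and the exponent of the logarithm decides.

  The map is \<open>u\<^sup>0 = E (n - 2) 2\<close> and \<open>u\<^sup>a = x\<^sub>a * E (n - 1) (5/2)\<close> for \<open>a = 1, \<dots>, n\<close>. It is unbounded
  because of \<open>u\<^sup>0\<close>, the fundamental solution damped by \<open>L powr - 2\<close>. As \<open>|x| powr (2 - n)\<close> is
  harmonic, the Laplacian of \<open>u\<^sup>0\<close> acquires another factor \<open>1 / L\<close> and has size \<open>E n 3\<close>. The Laplacian of
  \<open>u\<^sup>a\<close> has no such cancellation, and its size is \<open>E n (5/2)\<close>, that of \<open>u\<^sup>a / |x|\<^sup>2\<close>.

  For \<open>\<Omega>\<close> take the rotationally symmetric form \<open>\<Omega>\<^sub>0\<^sub>a = \<alpha> e\<^sub>a + \<beta> x\<^sub>a x = - \<Omega>\<^sub>a\<^sub>0\<close>, all other entries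
  being 0, where \<open>\<alpha>\<close> and \<open>\<beta>\<close> are radial. Since \<open>du\<^sup>0\<close> is a multiple \<open>P x\<close> of \<open>x\<close>, the \<open>n\<close> equations of
  the rows \<open>a\<close> collapse to one equation for \<open>\<tau> = \<alpha> + \<beta> |x|\<^sup>2\<close>, whose solution has size
  \<open>L powr (- 5/2) / L powr (- 2)\<close> times \<open>1 / |x|\<close>. The row 0 contains all
  tangential derivatives of the \<open>u\<^sup>a\<close> and then determines \<open>\<alpha>\<close>, of size
  \<open>L powr (- 3) / L powr (- 5/2)\<close> times \<open>1 / |x|\<close>. It is here that all \<open>n\<close> functions \<open>u\<^sup>a\<close> are
  needed: a single one has points on each sphere at which its gradient is radial. Both quotients are
  \<open>L powr (- 1/2)\<close>, so \<open>|\<Omega>| \<le> C * E 1 (1/2)\<close>, and \<open>|\<Omega>| powr n\<close> is bounded by a multiple of \<open>E n (n / 2)\<close>,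
  which is integrable because \<open>n / 2 > 1\<close>. The constant \<open>C\<close> does not depend on \<open>\<rho>\<close>, so the norm of
  \<open>\<Omega>\<close> tends to 0 as \<open>\<rho>\<close> grows (\<open>form_dot_connection\<close>, \<open>connection_bound\<close>,
  \<open>Lp_norm_connection_small\<close>).

  Away from the origin the system therefore holds pointwise. It also holds across the origin: the
  exponents 2 and \<open>5/2\<close> exceed 1, which makes \<open>u / |x|\<close>, \<open>du\<close>, \<open>du / |x|\<close> and the second derivatives
  integrable, and then a cutoff around 0 leaves no contribution in the limit
  (\<open>distr_partial_punctured\<close>). Integrability of \<open>E n q\<close> for \<open>q > 1\<close> comes from summing over exponentially
  shrinking balls (\<open>integrable_log_power\<close>).
\<close>

section \<open>Integration by parts for compactly supported functions\<close>

lemma partial_eqI: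
  assumes "(f has_derivative D) (at x)"
  shows "partial j f x = D (axis j 1)"
  unfolding partial_def using frechet_derivative_at[OF assms] by simp

lemma partial_has_derivative_along_axis:
  fixes f :: "real^'n::finite \<Rightarrow> real"
  assumes "f differentiable (at (x + t *\<^sub>R axis j 1))"
  shows "((\<lambda>t. f (x + t *\<^sub>R axis j 1)) has_real_derivative partial j f (x + t *\<^sub>R axis j 1)) (at t)"
proof -
  let ?D = "frechet_derivative f (at (x + t *\<^sub>R axis j 1))"
  have D: "(f has_derivative ?D) (at (x + t *\<^sub>R axis j 1))"
    using assms frechet_derivative_works by blast
  have lin: "?D (s *\<^sub>R axis j 1) = s * ?D (axis j 1)" for s
    using linear_scale[OF has_derivative_linear[OF D]] by simp
  have line: "((\<lambda>t. x + t *\<^sub>R axis j (1::real)) has_derivative (\<lambda>s. s *\<^sub>R axis j 1)) (at t)"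
    by (auto intro!: derivative_eq_intros)
  have "((\<lambda>t. f (x + t *\<^sub>R axis j 1)) has_derivative (\<lambda>s. ?D (s *\<^sub>R axis j 1))) (at t)"
    using has_derivative_compose[OF line D] .
  then show ?thesis
    unfolding has_field_derivative_def partial_def lin by (simp add: mult_commute_abs)
qed

text \<open>The difference quotients of \<open>f\<close> in the direction \<open>j\<close> have integral 0 by translation invariance of
  Lebesgue measure, and they converge to the partial derivative under a bound that comes from the mean
  value theorem. This avoids any use of Fubini's theorem.\<close>

lemma integral_partial_eq_0:
  fixes f :: "real^'n::finite \<Rightarrow> real"
  assumes diff: "\<And>x. f differentiable (at x)"
    and cont: "continuous_on UNIV (partial j f)"
    and cpt: "compact K" and supp: "\<And>x. x \<notin> K \<Longrightarrow> f x = 0"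
  shows "(LINT x|lborel. partial j f x) = 0"
proof -
  define e :: "real^'n" where "e = axis j 1"
  have ne: "norm e = 1" by (simp add: e_def)
  obtain R where R: "\<And>x. x \<in> K \<Longrightarrow> norm x \<le> R"
    using compact_imp_bounded[OF cpt] bounded_iff by metis
  define B where "B = cball (0::real^'n) (R + 1)"
  have fcont: "continuous_on UNIV f"
    using diff by (simp add: continuous_at_imp_continuous_on differentiable_imp_continuous_within)
  have f0: "f y = 0" if "norm y > R" for y using R[of y] supp[of y] that by force
  obtain M where M: "\<And>x. x \<in> cball 0 (R + 2) \<Longrightarrow> \<bar>partial j f x\<bar> \<le> M"
  proof -
    have "bounded (partial j f ` cball 0 (R + 2))"
      by (intro compact_imp_bounded compact_continuous_image compact_cball continuous_on_subset[OF cont]) simp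
    then obtain a where "\<forall>y \<in> partial j f ` cball 0 (R + 2). norm y \<le> a" unfolding bounded_iff by blast
    then show ?thesis using that[of a] by simp
  qed
  define h where "h i = inverse (real (Suc i))" for i
  have h: "h i > 0" "h i \<le> 1" for i by (auto simp: h_def divide_simps)
  have h0: "h \<longlonglongrightarrow> 0" unfolding h_def by (rule LIMSEQ_inverse_real_of_nat)
  define s where "s i x = (f (x + h i *\<^sub>R e) - f x) / h i" for i x
  have fm: "f \<in> borel_measurable borel" using fcont by (rule borel_measurable_continuous_onI)
  have fint: "integrable lborel f"
  proof -
    have "integrable lborel (\<lambda>x. indicator (cball 0 R) x *\<^sub>R f x)"
      by (intro borel_integrable_compact continuous_on_subset[OF fcont] compact_cball) simp
    moreover have "(\<lambda>x. indicator (cball 0 R) x *\<^sub>R f x) = f"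
      using f0 by (auto simp: indicator_def fun_eq_iff)
    ultimately show ?thesis by simp
  qed
  have shift: "integrable lborel (\<lambda>x. f (x + c))" "(LINT x|lborel. f (x + c)) = (LINT x|lborel. f x)" for c
  proof -
    have d: "distr lborel borel ((+) c) = (lborel :: (real^'n) measure)" by (rule lborel_distr_plus)
    have "integrable (distr lborel borel ((+) c)) f" using fint d by simp
    then show "integrable lborel (\<lambda>x. f (x + c))"
      by (subst (asm) integrable_distr_eq) (use fm in \<open>auto simp: add.commute\<close>)
    have "(LINT x|distr lborel borel ((+) c). f x) = (LINT x|lborel. f (c + x))"
      by (rule integral_distr) (use fm in auto)
    then show "(LINT x|lborel. f (x + c)) = (LINT x|lborel. f x)"
      using d by (simp add: add.commute)
  qed
  have sint: "(LINT x|lborel. s i x) = 0" for i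
    unfolding s_def using shift[of "h i *\<^sub>R e"] fint by simp
  \<comment> \<open>As the steps are at most 1, all difference quotients live on a ball of radius one larger.\<close>
  have bound: "norm (s i x) \<le> indicator B x * M" for i x
  proof (cases "x \<in> B")
    case True
    have "\<exists>z. 0 < z \<and> z < h i \<and> f (x + h i *\<^sub>R e) - f (x + 0 *\<^sub>R e) = (h i - 0) * partial j f (x + z *\<^sub>R e)"
      using MVT2[of 0 "h i" "\<lambda>t. f (x + t *\<^sub>R e)" "\<lambda>t. partial j f (x + t *\<^sub>R e)"] h[of i]
        partial_has_derivative_along_axis[where f = f and x = x and j = j, OF diff] unfolding e_def by blast
    then obtain z where z: "0 < z" "z < h i" "f (x + h i *\<^sub>R e) - f x = h i * partial j f (x + z *\<^sub>R e)"
      by auto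
    have "norm (x + z *\<^sub>R e) \<le> norm x + z" using norm_triangle_ineq[of x "z *\<^sub>R e"] z ne by simp
    also have "\<dots> \<le> R + 2" using z h[of i] True by (simp add: B_def)
    finally have "\<bar>partial j f (x + z *\<^sub>R e)\<bar> \<le> M" using M by simp
    then show ?thesis using z h[of i] True by (simp add: s_def)
  next
    case False
    then have "norm x > R + 1" by (simp add: B_def)
    moreover have "norm (x + h i *\<^sub>R e) \<ge> norm x - 1"
      using norm_diff_ineq[of x "h i *\<^sub>R e"] h[of i] ne by simp
    ultimately show ?thesis using False f0 by (simp add: s_def)
  qed
  have lim: "(\<lambda>i. s i x) \<longlonglongrightarrow> partial j f x" for x
  proof -
    have "((\<lambda>t. f (x + t *\<^sub>R e)) has_real_derivative partial j f x) (at 0)"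
      using partial_has_derivative_along_axis[where f = f and x = x and j = j and t = 0, OF diff] by (simp add: e_def)
    then have "((\<lambda>t. (f (x + t *\<^sub>R e) - f x) / t) \<longlongrightarrow> partial j f x) (at 0)"
      by (simp add: has_field_derivative_iff)
    then show ?thesis unfolding s_def
      by (rule filterlim_compose) (use h0 h in \<open>auto simp: filterlim_at less_imp_neq[THEN not_sym]\<close>)
  qed
  have "(\<lambda>i. LINT x|lborel. s i x) \<longlonglongrightarrow> (LINT x|lborel. partial j f x)"
  proof (rule integral_dominated_convergence[where w = "\<lambda>x. indicator B x * M"])
    show "partial j f \<in> borel_measurable lborel"
      using borel_measurable_continuous_onI[OF cont] by simp
    show "s i \<in> borel_measurable lborel" for i unfolding s_def using fm by measurable
    have "integrable lborel (\<lambda>x. indicator B x *\<^sub>R M)" unfolding B_def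
      by (intro borel_integrable_compact compact_cball) auto
    then show "integrable lborel (\<lambda>x. indicator B x * M)" by simp
  qed (use lim bound in auto)
  then show ?thesis using sint by (simp add: LIMSEQ_const_iff)
qed

lemma eq_0_off_support:
  assumes "x \<notin> closure {x. f x \<noteq> 0}" 
  shows "f x = 0"
  using assms closure_subset[of "{x. f x \<noteq> 0}"] by auto

lemma partial_eq_0_off_support:
  fixes f :: "real^'n::finite \<Rightarrow> real"
  assumes "x \<notin> closure {x. f x \<noteq> 0}"
  shows "partial j f x = 0"
proof -
  have "(f has_derivative (\<lambda>_. 0)) (at x)"
  proof (rule has_derivative_transform_within_open[where f = "\<lambda>_. 0" and s = "- closure {x. f x \<noteq> 0}"])
    show "0 = f y" if "y \<in> - closure {x. f x \<noteq> 0}" for y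
      using eq_0_off_support[of y f] that by simp
  qed (use assms in auto)
  then show ?thesis by (rule partial_eqI)
qed

lemma partial_mult:
  fixes f g :: "real^'n::finite \<Rightarrow> real"
  assumes "f differentiable (at x)" "g differentiable (at x)"
  shows "partial j (\<lambda>x. f x * g x) x = partial j f x * g x + f x * partial j g x"
proof -
  have "((\<lambda>x. f x * g x) has_derivative
      (\<lambda>h. f x * frechet_derivative g (at x) h + frechet_derivative f (at x) h * g x)) (at x)"
    using assms by (intro has_derivative_mult) (auto simp: frechet_derivative_works)
  from partial_eqI[OF this] show ?thesis by (simp add: partial_def)
qed

text \<open>The product \<open>v * \<Phi>\<close>, extended by 0 outside \<open>U\<close>, is continuously differentiable on the whole space,
  because the support of \<open>\<Phi>\<close> has a neighbourhood in \<open>U\<close>.\<close>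

lemma integral_by_parts_open:
  fixes v \<Phi> g :: "real^'n::finite \<Rightarrow> real"
  assumes U: "open U"
    and v: "\<And>x. x \<in> U \<Longrightarrow> v differentiable (at x)"
    and g: "\<And>x. x \<in> U \<Longrightarrow> partial j v x = g x" "continuous_on U g"
    and \<Phi>: "\<And>x. \<Phi> differentiable (at x)" "continuous_on UNIV (partial j \<Phi>)"
    and cpt: "compact (closure {x. \<Phi> x \<noteq> 0})" and sub: "closure {x. \<Phi> x \<noteq> 0} \<subseteq> U"
  shows "(LINT x|lebesgue_on U. g x * \<Phi> x + v x * partial j \<Phi> x) = 0"
proof -
  let ?K = "closure {x. \<Phi> x \<noteq> 0}"
  define f where "f x = (if x \<in> U then v x * \<Phi> x else 0)" for x
  define F where "F x = (if x \<in> U then g x * \<Phi> x + v x * partial j \<Phi> x else 0)" for x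
  have oK: "open (- ?K)" by (rule open_Compl[OF closed_closure])
  have out: "f x = 0" "F x = 0" if "x \<notin> ?K" for x
    using eq_0_off_support[OF that] partial_eq_0_off_support[OF that]
    by (auto simp: f_def F_def)
  have der: "f differentiable (at x) \<and> partial j f x = F x" for x
  proof (cases "x \<in> U")
    case True
    have "((\<lambda>x. v x * \<Phi> x) has_derivative frechet_derivative (\<lambda>x. v x * \<Phi> x) (at x)) (at x)"
      using v[OF True] \<Phi>(1)[of x] by (simp flip: frechet_derivative_works)
    then have d: "(f has_derivative frechet_derivative (\<lambda>x. v x * \<Phi> x) (at x)) (at x)"
      by (rule has_derivative_transform_within_open[OF _ U True]) (simp add: f_def)
    then have "partial j f x = partial j (\<lambda>x. v x * \<Phi> x) x"
      using partial_eqI[OF d] by (simp add: partial_def)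
    also have "\<dots> = F x" using True g(1)[OF True]
      by (subst partial_mult) (use v[OF True] \<Phi>(1) in \<open>auto simp: F_def\<close>)
    finally show ?thesis using d differentiableI by blast
  next
    case False
    then have x: "x \<in> - ?K" using sub by auto
    have d: "(f has_derivative (\<lambda>_. 0)) (at x)"
    proof (rule has_derivative_transform_within_open[OF _ oK x])
      show "((\<lambda>_. 0) has_derivative (\<lambda>_. 0)) (at x)" by simp
      show "0 = f y" if "y \<in> - ?K" for y using out(1)[of y] that by simp
    qed
    show ?thesis using partial_eqI[OF d] differentiableI[OF d] out(2)[of x] x by simp
  qed
  have "continuous_on U F"
  proof -
    have "continuous_on U v" "continuous_on UNIV \<Phi>"
      using v \<Phi>(1) by (auto simp: continuous_at_imp_continuous_on differentiable_imp_continuous_within)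
    moreover from this have "continuous_on U \<Phi>" "continuous_on U (partial j \<Phi>)"
      using continuous_on_subset[OF _ subset_UNIV] \<Phi>(2) by simp_all
    ultimately have "continuous_on U (\<lambda>x. g x * \<Phi> x + v x * partial j \<Phi> x)"
      by (intro continuous_intros g(2))
    then show ?thesis by (rule continuous_on_eq) (simp add: F_def)
  qed
  moreover have "continuous_on (- ?K) F"
    by (rule continuous_on_eq[of _ "\<lambda>_. 0"]) (use out in auto)
  ultimately have "continuous_on (U \<union> - ?K) F" by (intro continuous_on_open_Un U oK)
  moreover have "U \<union> - ?K = UNIV" using sub by auto
  ultimately have contF: "continuous_on UNIV F" by simp
  have "partial j f = F" using der by auto
  with integral_partial_eq_0[of f j ?K] der contF cpt out(1)
  have "(LINT x|lborel. F x) = 0" by auto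
  moreover have "(LINT x|lebesgue. F x) = (LINT x|lborel. F x)"
    by (rule integral_completion) (use borel_measurable_continuous_onI[OF contF] in simp)
  moreover have "(LINT x|lebesgue_on U. g x * \<Phi> x + v x * partial j \<Phi> x) = (LINT x|lebesgue. F x)"
    using U integral_restrict[of U UNIV "\<lambda>x. g x * \<Phi> x + v x * partial j \<Phi> x"] unfolding F_def
    by (simp add: lebesgue_on_UNIV_eq)
  ultimately show ?thesis by simp
qed

section \<open>Cutoffs and test functions\<close>

text \<open>A continuously differentiable function that vanishes for \<open>k * |x|\<^sup>2 \<le> 1\<close> and tends to 1 away from 0 as
  \<open>k\<close> grows. It is \<open>m\<^sup>2 / (1 + m\<^sup>2)\<close> for \<open>m = max 0 (k * |x|\<^sup>2 - 1)\<close>, where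
  the square makes the positive part differentiable.\<close>

definition cutoff :: "real \<Rightarrow> 'a::real_inner \<Rightarrow> real" where
  "cutoff k x = 1 - 1 / (1 + (max 0 (k * (x \<bullet> x) - 1))\<^sup>2)"

text \<open>The factor of \<open>x\<close> in the gradient of the cutoff.\<close>

definition cutoff_slope :: "real \<Rightarrow> 'a::real_inner \<Rightarrow> real" where
  "cutoff_slope k x =
     (let m = max 0 (k * (x \<bullet> x) - 1) in 4 * k * m / (1 + m\<^sup>2)\<^sup>2)"

lemma max_0_square_has_derivative:
  "((\<lambda>t::real. (max 0 t)\<^sup>2) has_real_derivative 2 * max 0 t) (at t)"
proof -
  consider "t < 0" | "t = 0" | "t > 0" by linarith
  then show ?thesis
  proof cases
    case 1
    have "((\<lambda>_. 0) has_real_derivative 2 * max 0 t) (at t)" using 1 by simp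
    then show ?thesis
      by (rule has_field_derivative_transform_within_open[of _ _ _ "{..<0}"]) (use 1 in auto)
  next
    case 2
    have "((\<lambda>h. (max 0 h)\<^sup>2 / h) \<longlongrightarrow> 0) (at (0::real))"
    proof (rule Lim_null_comparison)
      show "\<forall>\<^sub>F h in at (0::real). norm ((max 0 h)\<^sup>2 / h) \<le> \<bar>h\<bar>"
        by (rule always_eventually) (auto simp: max_def power2_eq_square)
      show "((\<lambda>h. \<bar>h\<bar>) \<longlongrightarrow> 0) (at (0::real))"
        using tendsto_rabs[OF tendsto_ident_at, of "0::real" UNIV] by simp
    qed
    then show ?thesis using 2 by (simp add: has_field_derivative_iff)
  next
    case 3
    have "((\<lambda>t. t\<^sup>2) has_real_derivative 2 * max 0 t) (at t)"
      using 3 by (auto intro!: derivative_eq_intros)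
    then show ?thesis
      by (rule has_field_derivative_transform_within_open[of _ _ _ "{0<..}"]) (use 3 in auto)
  qed
qed

lemma cutoff_has_derivative:
  "(cutoff k has_derivative (\<lambda>h. cutoff_slope k x * (x \<bullet> h))) (at x)"
proof -
  define t where "t = k * (x \<bullet> x) - 1"
  have pos: "1 + (max 0 t)\<^sup>2 > 0" by (simp add: add_pos_nonneg)
  have "((\<lambda>s. 1 - 1 / (1 + s)) has_real_derivative 1 / (1 + (max 0 t)\<^sup>2)\<^sup>2) (at ((max 0 t)\<^sup>2))"
    using pos by (auto intro!: derivative_eq_intros simp: power2_eq_square)
  from DERIV_chain2[OF this max_0_square_has_derivative]
  have D: "((\<lambda>t. 1 - 1 / (1 + (max 0 t)\<^sup>2)) has_derivative
      (\<lambda>h. 2 * max 0 t / (1 + (max 0 t)\<^sup>2)\<^sup>2 * h)) (at (k * (x \<bullet> x) - 1))"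
    unfolding has_field_derivative_def t_def[symmetric]
    by (rule has_derivative_eq_rhs) (auto simp: fun_eq_iff)
  have "((\<lambda>x. k * (x \<bullet> x) - 1) has_derivative (\<lambda>h. 2 * k * (x \<bullet> h))) (at x)"
    by (auto intro!: derivative_eq_intros simp: inner_commute algebra_simps)
  from has_derivative_compose[OF this D]
  show ?thesis
    unfolding cutoff_def[abs_def] cutoff_slope_def Let_def t_def by (simp add: mult_ac)
qed

lemma cutoff_bounds: "0 \<le> cutoff k x" "cutoff k x \<le> 1"
  by (auto simp: cutoff_def divide_le_eq add_pos_nonneg)

lemma cutoff_eq_0: "k * (x \<bullet> x) \<le> 1 \<Longrightarrow> cutoff k x = 0"
  by (simp add: cutoff_def)

text \<open>The gradient of the cutoff is at most \<open>8 / |x|\<close>, uniformly in \<open>k\<close>: with \<open>m\<close> as above,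
  \<open>k * |x|\<^sup>2 = m + 1\<close> wherever the gradient is not 0.\<close>

lemma cutoff_slope_bound:
  assumes "k > 0"
  shows "\<bar>cutoff_slope k x\<bar> * (x \<bullet> x) \<le> 8"
proof -
  define m where "m = max 0 (k * (x \<bullet> x) - 1)"
  have "1 + m\<^sup>2 > 0" by (simp add: add_pos_nonneg)
  then have pos: "0 < (1 + m\<^sup>2)\<^sup>2" by simp
  have "4 * m * (k * (x \<bullet> x)) \<le> 8 * (1 + m\<^sup>2)\<^sup>2"
  proof (cases "m = 0")
    case False
    then have "k * (x \<bullet> x) = m + 1" by (simp add: m_def max_def split: if_splits)
    moreover have "4 * m * (m + 1) \<le> 8 * (1 + m\<^sup>2)\<^sup>2"
    proof -
      have "m \<le> 1 + m\<^sup>2" using zero_le_power2[of "m - 1"] zero_le_power2[of m]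
        unfolding power2_diff power_one by linarith
      then have "4 * m * (m + 1) \<le> 8 * (1 + m\<^sup>2)"
        using zero_le_power2[of m] by (simp add: power2_eq_square algebra_simps)
      also have "\<dots> \<le> 8 * (1 + m\<^sup>2)\<^sup>2"
        using self_le_power[of "1 + m\<^sup>2" 2] by simp
      finally show ?thesis .
    qed
    ultimately show ?thesis by simp
  qed (simp add: pos less_imp_le)
  then show ?thesis using assms pos
    by (simp add: cutoff_slope_def Let_def flip: m_def) (simp add: divide_simps abs_mult mult_ac m_def)
qed

lemma cutoff_limits:
  assumes "x \<noteq> 0"
  shows "(\<lambda>i. cutoff (real (Suc i)) x) \<longlonglongrightarrow> 1" "(\<lambda>i. cutoff_slope (real (Suc i)) x) \<longlonglongrightarrow> 0"
proof -
  define c where "c = x \<bullet> x"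
  have c: "c > 0" using assms by (simp add: c_def)
  show "(\<lambda>i. cutoff (real (Suc i)) x) \<longlonglongrightarrow> 1" 
    unfolding cutoff_def c_def[symmetric] using c by real_asymp
  show "(\<lambda>i. cutoff_slope (real (Suc i)) x) \<longlonglongrightarrow> 0"
    unfolding cutoff_slope_def c_def[symmetric] Let_def using c by real_asymp
qed

lemma cutoff_continuous: "continuous_on A (cutoff k)" "continuous_on A (cutoff_slope k)"
  unfolding cutoff_def[abs_def] cutoff_slope_def[abs_def] Let_def
  by (auto intro!: continuous_intros simp: add_nonneg_eq_0_iff)

lemma partial_cutoff: "cutoff k differentiable (at x)" "partial j (cutoff k) x = cutoff_slope k x * x $ j"
  using cutoff_has_derivative[of k x] differentiableI partial_eqI[OF cutoff_has_derivative[of k x]]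
  by (auto simp: inner_axis)

lemma test_function_C1:
  assumes "\<phi> \<in> test_functions U"
  shows "\<phi> differentiable (at x)" "continuous_on UNIV (partial j \<phi>)" "continuous_on UNIV \<phi>"
    "partial j \<phi> \<in> test_functions U"
    "compact (closure {x. \<phi> x \<noteq> 0})" "closure {x. \<phi> x \<noteq> 0} \<subseteq> U"
proof -
  have C: "C_k k \<phi>" for k using assms by (simp add: test_functions_def)
  show "\<phi> differentiable (at x)" "continuous_on UNIV (partial j \<phi>)" "continuous_on UNIV \<phi>"
    using C[of 0] C[of "Suc 0"] by (auto simp: differentiable_on_def)
  show supp: "compact (closure {x. \<phi> x \<noteq> 0})" "closure {x. \<phi> x \<noteq> 0} \<subseteq> U"
    using assms by (auto simp: test_functions_def)
  have "{x. partial j \<phi> x \<noteq> 0} \<subseteq> closure {x. \<phi> x \<noteq> 0}"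
    using partial_eq_0_off_support by blast
  then have sub: "closure {x. partial j \<phi> x \<noteq> 0} \<subseteq> closure {x. \<phi> x \<noteq> 0}"
    by (simp add: closure_minimal)
  moreover from this have "compact (closure {x. partial j \<phi> x \<noteq> 0})"
    using compact_closure compact_imp_bounded[OF supp(1)] bounded_subset closed_closure compact_eq_bounded_closed by blast
  moreover have "C_k k (partial j \<phi>)" for k using C[of "Suc k"] by simp
  ultimately show "partial j \<phi> \<in> test_functions U"
    using supp(2) by (simp add: test_functions_def)
qed

text \<open>The bound on \<open>|x| * \<phi> x\<close> serves to absorb the weight when \<open>v\<close> is written as \<open>v / |x|\<close> times \<open>|x|\<close>.\<close>

lemma test_function_bounded:
  assumes "\<phi> \<in> test_functions U"
  obtains M where "M \<ge> 0" "\<And>x. \<bar>\<phi> x\<bar> \<le> M" "\<And>x. norm x * \<bar>\<phi> x\<bar> \<le> M"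
proof -
  let ?K = "closure {x. \<phi> x \<noteq> 0}"
  note \<phi> = test_function_C1[OF assms]
  have "bounded ((\<lambda>x. (1 + norm x) * \<bar>\<phi> x\<bar>) ` ?K)"
    by (intro compact_imp_bounded compact_continuous_image \<phi>(5) continuous_intros
        continuous_on_subset[OF \<phi>(3) subset_UNIV])
  then obtain M where M: "\<forall>y \<in> (\<lambda>x. (1 + norm x) * \<bar>\<phi> x\<bar>) ` ?K. norm y \<le> M"
    unfolding bounded_iff by blast
  have le: "(1 + norm x) * \<bar>\<phi> x\<bar> \<le> max 0 M" for x
  proof (cases "x \<in> ?K")
    case True
    then have "norm ((1 + norm x) * \<bar>\<phi> x\<bar>) \<le> M" using M by blast
    then show ?thesis by simp
  qed (use eq_0_off_support[of x \<phi>] in simp)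
  have split: "(1 + norm x) * \<bar>\<phi> x\<bar> = \<bar>\<phi> x\<bar> + norm x * \<bar>\<phi> x\<bar>" for x
    by (simp add: algebra_simps)
  have nn: "0 \<le> norm x * \<bar>\<phi> x\<bar>" for x by simp
  show thesis
  proof (rule that[of "max 0 M"])
    show "\<bar>\<phi> x\<bar> \<le> max 0 M" for x using le[of x] nn[of x] unfolding split by linarith
    show "norm x * \<bar>\<phi> x\<bar> \<le> max 0 M" for x using le[of x] unfolding split by linarith
  qed simp
qed

lemma borel_imp_lebesgue_on:
  assumes "f \<in> borel_measurable borel"
  shows "f \<in> borel_measurable (lebesgue_on S)"
  using assms by (intro measurable_restrict_space1 measurable_completion) simp

lemma AE_lebesgue_on_neq:
  fixes a :: "'a::euclidean_space"
  assumes "S \<in> sets lebesgue"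
  shows "AE x in lebesgue_on S. x \<noteq> a"
proof -
  have "AE x in lebesgue. x \<noteq> a" by (rule AE_completion[OF AE_lborel_singleton])
  then show ?thesis using assms by (subst AE_restrict_space_iff) auto
qed

lemma integrable_mult_bounded:
  fixes f h :: "'a \<Rightarrow> real"
  assumes "integrable M f" "h \<in> borel_measurable M" "\<And>x. \<bar>h x\<bar> \<le> C"
  shows "integrable M (\<lambda>x. f x * h x)"
proof (rule Bochner_Integration.integrable_bound)
  show "integrable M (\<lambda>x. C * \<bar>f x\<bar>)" using assms(1) by simp
  show "AE x in M. norm (f x * h x) \<le> norm (C * \<bar>f x\<bar>)"
  proof (rule AE_I2)
    fix x
    have "0 \<le> C" using assms(3)[of x] by linarith
    then show "norm (f x * h x) \<le> norm (C * \<bar>f x\<bar>)"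
      using mult_right_mono[OF assms(3)[of x], of "\<bar>f x\<bar>"] by (simp add: abs_mult mult.commute)
  qed
qed (use assms in measurable)

section \<open>Distributional derivatives across an isolated singularity\<close>

text \<open>Apply integration by parts on \<open>U - {0}\<close> to \<open>v\<close> and the product of a cutoff with \<open>\<phi>\<close>. The term with the derivative
  of the cutoff is dominated by a multiple of \<open>|v| / |x|\<close>, which is integrable, and tends to 0
  pointwise, so it vanishes in the limit.\<close>

lemma distr_partial_punctured:
  fixes v g :: "real^'n::finite \<Rightarrow> real"
  assumes U: "open U"
    and v: "\<And>x. x \<in> U - {0} \<Longrightarrow> v differentiable (at x)"
    and g: "\<And>x. x \<in> U - {0} \<Longrightarrow> partial j v x = g x" "continuous_on (U - {0}) g"
    and int_v: "integrable (lebesgue_on U) (\<lambda>x. v x / norm x)"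
    and int_g: "integrable (lebesgue_on U) g"
    and \<phi>: "\<phi> \<in> test_functions U"
  shows "distr_partial j (regular_distr U v) \<phi> = regular_distr U g \<phi>"
proof -
  note T = test_function_C1[OF \<phi>]
  define \<psi> where "\<psi> = partial j \<phi>"
  have \<psi>: "\<psi> \<in> test_functions U" using T(4) by (simp add: \<psi>_def)
  obtain M where M: "M \<ge> 0" "\<And>x. \<bar>\<phi> x\<bar> \<le> M" by (rule test_function_bounded[OF \<phi>]) (rule that)
  obtain M' where M': "\<And>x. norm x * \<bar>\<psi> x\<bar> \<le> M'" by (rule test_function_bounded[OF \<psi>]) (rule that)
  \<comment> \<open>Only \<open>v / |x|\<close> is known to be measurable and integrable, so everything is expressed through it.\<close>
  define w where "w x = v x / norm x" for x
  have vw: "v x = w x * norm x" if "x \<noteq> 0" for x using that by (simp add: w_def)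
  have [measurable]: "w \<in> borel_measurable (lebesgue_on U)" "g \<in> borel_measurable (lebesgue_on U)"
    using int_v int_g by (auto simp: w_def[abs_def])
  have [measurable]: "\<phi> \<in> borel_measurable (lebesgue_on U)" "\<psi> \<in> borel_measurable (lebesgue_on U)"
    "cutoff k \<in> borel_measurable (lebesgue_on U)" "cutoff_slope k \<in> borel_measurable (lebesgue_on U)" for k
    by (auto intro!: borel_imp_lebesgue_on borel_measurable_continuous_onI cutoff_continuous
        T(3) test_function_C1(3)[OF \<psi>])
  have [measurable]: "norm \<in> borel_measurable (lebesgue_on U)" "(\<lambda>x. x $ j) \<in> borel_measurable (lebesgue_on U)"
    by (auto intro!: borel_imp_lebesgue_on borel_measurable_continuous_onI continuous_intros)
  have int_w: "integrable (lebesgue_on U) w" using int_v by (simp add: w_def[abs_def])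
  have int1: "integrable (lebesgue_on U) (\<lambda>x. g x * \<phi> x)"
    using M(2) by (intro integrable_mult_bounded[OF int_g]) auto
  have int2: "integrable (lebesgue_on U) (\<lambda>x. w x * (norm x * \<psi> x))"
    using M' by (intro integrable_mult_bounded[where C = M'])
      (use int_v in \<open>auto simp: w_def[abs_def] abs_mult\<close>)
  \<comment> \<open>The integrand of integration by parts for the product of the \<open>i\<close>-th cutoff with \<open>\<phi>\<close>.\<close>
  define F where "F i x = cutoff (real (Suc i)) x * (g x * \<phi> x + w x * (norm x * \<psi> x))
      + cutoff_slope (real (Suc i)) x * (x $ j * norm x) * (w x * \<phi> x)" for i x
  have F0: "(LINT x|lebesgue_on U. F i x) = 0" for i
  proof -
    define k where "k = real (Suc i)"
    have k: "k > 0" by (simp add: k_def)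
    define \<Phi> where "\<Phi> x = cutoff k x * \<phi> x" for x
    have p\<Phi>: "partial j \<Phi> x = cutoff_slope k x * x $ j * \<phi> x + cutoff k x * \<psi> x" for x
      unfolding \<Phi>_def by (subst partial_mult) (auto simp: partial_cutoff T(1) \<psi>_def)
    have closed: "closed {x::real^'n. 1 \<le> k * (x \<bullet> x)}"
      by (intro closed_Collect_le continuous_intros)
    have "{x. \<Phi> x \<noteq> 0} \<subseteq> closure {x. \<phi> x \<noteq> 0} \<inter> {x. 1 \<le> k * (x \<bullet> x)}"
    proof (intro subsetI IntI)
      fix x assume x: "x \<in> {x. \<Phi> x \<noteq> 0}"
      then show "x \<in> closure {x. \<phi> x \<noteq> 0}"
        using closure_subset[of "{x. \<phi> x \<noteq> 0}"] by (auto simp: \<Phi>_def)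
      show "x \<in> {x. 1 \<le> k * (x \<bullet> x)}"
        using x cutoff_eq_0[of k x] by (cases "1 \<le> k * (x \<bullet> x)") (auto simp: \<Phi>_def)
    qed
    then have supp: "closure {x. \<Phi> x \<noteq> 0} \<subseteq> closure {x. \<phi> x \<noteq> 0} \<inter> {x. 1 \<le> k * (x \<bullet> x)}"
      using closed by (intro closure_minimal closed_Int) auto
    have "(LINT x|lebesgue_on (U - {0}). g x * \<Phi> x + v x * partial j \<Phi> x) = 0"
    proof (rule integral_by_parts_open[OF _ v g])
      show "open (U - {0})" using U by (simp add: open_delete)
      show "\<Phi> differentiable (at x)" for x unfolding \<Phi>_def
        by (intro differentiable_mult partial_cutoff T(1))
      show "continuous_on UNIV (partial j \<Phi>)"
        unfolding p\<Phi>[abs_def]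
        by (intro continuous_intros cutoff_continuous T(3) test_function_C1(3)[OF \<psi>])
      show "compact (closure {x. \<Phi> x \<noteq> 0})"
        using supp bounded_subset[OF compact_imp_bounded[OF T(5)]] by (simp add: compact_eq_bounded_closed)
      show "closure {x. \<Phi> x \<noteq> 0} \<subseteq> U - {0}" using supp T(6) by auto
    qed auto
    moreover have "(if x \<in> U - {0} then g x * \<Phi> x + v x * partial j \<Phi> x else 0) = (if x \<in> U then F i x else 0)" for x
    proof (cases "x = 0")
      case True
      then show ?thesis by (simp add: F_def cutoff_eq_0)
    next
      case False
      then show ?thesis by (simp add: F_def p\<Phi> \<Phi>_def vw k_def algebra_simps)
    qed
    ultimately show ?thesis
      using integral_restrict[of U UNIV "F i"] U open_delete[OF U, of 0]
        integral_restrict[of "U - {0}" UNIV "\<lambda>x. g x * \<Phi> x + v x * partial j \<Phi> x"]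
      by (simp add: lebesgue_on_UNIV_eq)
  qed
  have "(\<lambda>i. LINT x|lebesgue_on U. F i x) \<longlonglongrightarrow> (LINT x|lebesgue_on U. g x * \<phi> x + w x * (norm x * \<psi> x))"
  proof (rule integral_dominated_convergence[where w = "\<lambda>x. \<bar>g x * \<phi> x + w x * (norm x * \<psi> x)\<bar> + 8 * M * \<bar>w x\<bar>"])
    show "integrable (lebesgue_on U) (\<lambda>x. \<bar>g x * \<phi> x + w x * (norm x * \<psi> x)\<bar> + 8 * M * \<bar>w x\<bar>)"
      by (intro Bochner_Integration.integrable_add integrable_abs integrable_mult_right int1 int2 int_w)
    have null: "AE x in lebesgue_on U. x \<noteq> 0" using U by (intro AE_lebesgue_on_neq) simp
    show "AE x in lebesgue_on U. (\<lambda>i. F i x) \<longlonglongrightarrow> g x * \<phi> x + w x * (norm x * \<psi> x)"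
      using null
    proof eventually_elim
      case (elim x)
      have "(\<lambda>i. F i x) \<longlonglongrightarrow> 1 * (g x * \<phi> x + w x * (norm x * \<psi> x)) + 0 * (x $ j * norm x) * (w x * \<phi> x)"
        unfolding F_def by (intro tendsto_intros cutoff_limits elim)
      then show ?case by simp
    qed
    show "AE x in lebesgue_on U. norm (F i x) \<le> \<bar>g x * \<phi> x + w x * (norm x * \<psi> x)\<bar> + 8 * M * \<bar>w x\<bar>" for i
    proof (rule AE_I2)
      fix x
      define k where "k = real (Suc i)"
      have k: "k > 0" by (simp add: k_def)
      have "\<bar>cutoff_slope k x * (x $ j * norm x)\<bar> \<le> \<bar>cutoff_slope k x\<bar> * (norm x * norm x)"
        unfolding abs_mult by (intro mult_mono) (auto simp: component_le_norm_cart)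
      also have "\<dots> \<le> 8" using cutoff_slope_bound[OF k, of x] by (simp add: dot_square_norm power2_eq_square)
      finally have 1: "\<bar>cutoff_slope k x * (x $ j * norm x)\<bar> \<le> 8" .
      have "\<bar>cutoff_slope k x * (x $ j * norm x) * (w x * \<phi> x)\<bar> \<le> 8 * (\<bar>w x\<bar> * M)"
        unfolding abs_mult[of "cutoff_slope k x * (x $ j * norm x)"] abs_mult[of "w x"]
        by (intro mult_mono 1 M) auto
      moreover have "\<bar>cutoff k x * (g x * \<phi> x + w x * (norm x * \<psi> x))\<bar> \<le> \<bar>g x * \<phi> x + w x * (norm x * \<psi> x)\<bar>"
        unfolding abs_mult[of "cutoff k x"] using cutoff_bounds[of k x] by (simp add: mult_left_le_one_le)
      ultimately show "norm (F i x) \<le> \<bar>g x * \<phi> x + w x * (norm x * \<psi> x)\<bar> + 8 * M * \<bar>w x\<bar>"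
        unfolding F_def k_def[symmetric] real_norm_def by (simp add: mult_ac)
    qed
    show "F i \<in> borel_measurable (lebesgue_on U)" for i unfolding F_def[abs_def] by measurable
  qed measurable
  then have "(LINT x|lebesgue_on U. g x * \<phi> x + w x * (norm x * \<psi> x)) = 0"
    using F0 by (simp add: LIMSEQ_const_iff)
  then have sum0: "(LINT x|lebesgue_on U. g x * \<phi> x) + (LINT x|lebesgue_on U. w x * (norm x * \<psi> x)) = 0"
    using int1 int2 by simp
  have "(LINT x|lebesgue_on U. v x * \<psi> x) = (LINT x|lebesgue_on U. w x * (norm x * \<psi> x))"
  proof (rule integral_cong_AE)
    show "AE x in lebesgue_on U. v x * \<psi> x = w x * (norm x * \<psi> x)"
      using AE_lebesgue_on_neq[of U 0] U by (auto elim!: eventually_mono simp: vw)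
    \<comment> \<open>The value of \<open>v\<close> at 0 is arbitrary and may differ from \<open>w 0 * norm 0 = 0\<close>.\<close>
    have "(\<lambda>x. if x = 0 then v 0 else w x * norm x) \<in> borel_measurable (lebesgue_on U)"
    proof (rule measurable_If)
      show "{x \<in> space (lebesgue_on U). x = 0} \<in> sets (lebesgue_on U)"
      proof -
        have "{x \<in> space (lebesgue_on U). x = 0} = U \<inter> {0}" by (auto simp: space_restrict_space)
        also have "\<dots> \<in> sets (lebesgue_on U)" by (subst sets_restrict_space) auto
        finally show ?thesis .
      qed
    qed measurable
    moreover have "(\<lambda>x. if x = 0 then v 0 else w x * norm x) = v" using vw by auto
    ultimately show "(\<lambda>x. v x * \<psi> x) \<in> borel_measurable (lebesgue_on U)" by simp
  qed measurable
  then show ?thesis using sum0 by (simp add: distr_partial_def regular_distr_def \<psi>_def)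
qed

section \<open>Powers of the norm and of its logarithm\<close>

text \<open>In dimension \<open>n\<close>, the power \<open>p = n\<close> is critical: integrability near 0 then holds exactly for \<open>q > 1\<close>. With
  \<open>\<rho> \<ge> 1\<close> the base of the logarithmic factor is at least 1 on the unit ball. At the origin the value is 0, since
  \<open>0 powr a = 0\<close>.\<close>

definition log_power :: "real \<Rightarrow> real \<Rightarrow> real \<Rightarrow> 'a::real_inner \<Rightarrow> real" where
  "log_power \<rho> p q x = norm x powr (- p) * (\<rho> - ln (norm x)) powr (- q)"

text \<open>The factor of \<open>x\<close> in the gradient of \<open>log_power\<close>; the family of profiles is closed under this
  operation.\<close>

definition log_power_slope :: "real \<Rightarrow> real \<Rightarrow> real \<Rightarrow> 'a::real_inner \<Rightarrow> real" where
  "log_power_slope \<rho> p q x = q * log_power \<rho> (p + 2) (q + 1) x - p * log_power \<rho> (p + 2) q x"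

lemma log_power_nonneg [simp]: "0 \<le> log_power \<rho> p q x"
  by (simp add: log_power_def)

lemma log_power_0 [simp]: "log_power \<rho> p q 0 = 0"
  by (simp add: log_power_def)

lemma log_power_mult:
  "log_power \<rho> p q x * log_power \<rho> p' q' x = log_power \<rho> (p + p') (q + q') x"
proof -
  have "a powr - (s + t) = a powr - s * a powr - t" for a s t :: real
    by (simp add: powr_add[symmetric])
  then show ?thesis by (simp only: log_power_def mult_ac)
qed

lemma log_power_powr:
  "log_power \<rho> p q x powr s = log_power \<rho> (p * s) (q * s) x"
  by (simp add: log_power_def powr_mult powr_powr)

lemma norm_log_power: "norm x * log_power \<rho> (p + 1) q x = log_power \<rho> p q x"
  by (simp add: log_power_def mult.assoc[symmetric] powr_mult_base)

lemma inner_log_power: "(x \<bullet> x) * log_power \<rho> (p + 2) q x = log_power \<rho> p q x"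
proof -
  have "norm x * (norm x * log_power \<rho> (p + 1 + 1) q x) = log_power \<rho> p q x"
    by (simp only: norm_log_power)
  then show ?thesis by (simp add: dot_square_norm power2_eq_square mult.assoc add.commute)
qed

context
  fixes x :: "'a::real_inner" and \<rho> :: real
  assumes x: "norm x < 1" and \<rho>: "\<rho> \<ge> 1"
begin

lemma ln_norm_le_0: "ln (norm x) \<le> 0"
  using x by (cases "x = 0") auto

lemma log_power_mono:
  assumes "p \<le> p'" "q' \<le> q"
  shows "log_power \<rho> p q x \<le> log_power \<rho> p' q' x"
proof (cases "x = 0")
  case False
  then have "norm x powr (- p) \<le> norm x powr (- p')"
    using x assms by (intro powr_mono') auto
  moreover have "(\<rho> - ln (norm x)) powr (- q) \<le> (\<rho> - ln (norm x)) powr (- q')"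
    using ln_norm_le_0 \<rho> assms by (intro powr_mono) auto
  ultimately show ?thesis unfolding log_power_def by (intro mult_mono) auto
qed simp

text \<open>A surplus \<open>r\<close> in the exponent of the logarithm is worth a factor that tends to 0 as \<open>\<rho>\<close> grows. This
  is the source of the smallness of the connection form.\<close>

lemma log_power_le_scaled:
  assumes "r \<ge> 0"
  shows "log_power \<rho> p (q + r) x \<le> \<rho> powr (- r) * log_power \<rho> p q x"
proof -
  have "(\<rho> - ln (norm x)) powr (- r) \<le> \<rho> powr (- r)"
    using ln_norm_le_0 \<rho> assms by (intro powr_mono2') auto
  then have "log_power \<rho> p q x * (\<rho> - ln (norm x)) powr (- r) \<le> log_power \<rho> p q x * \<rho> powr (- r)"
    by (rule mult_left_mono) simp
  moreover have "log_power \<rho> p (q + r) x = log_power \<rho> p q x * (\<rho> - ln (norm x)) powr (- r)"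
    by (simp add: log_power_def powr_add[symmetric] mult.assoc)
  ultimately show ?thesis by (simp add: mult.commute)
qed

text \<open>Monotonicity in \<open>\<rho>\<close> makes a single integrable majorant sufficient for all \<open>\<rho> \<ge> 1\<close>.\<close>

lemma log_power_le_shift_1:
  assumes "q \<ge> 0"
  shows "log_power \<rho> p q x \<le> log_power 1 p q x"
  unfolding log_power_def
  using ln_norm_le_0 \<rho> assms by (intro mult_left_mono powr_mono2') auto

lemma log_power_pos: "x \<noteq> 0 \<Longrightarrow> 0 < log_power \<rho> p q x"
  using ln_norm_le_0 \<rho> unfolding log_power_def by (intro mult_pos_pos) (simp_all del: ln_le_zero_iff)

lemma log_power_has_derivative:
  assumes "x \<noteq> 0"
  shows "(log_power \<rho> p q has_derivative (\<lambda>h. log_power_slope \<rho> p q x * (x \<bullet> h))) (at x)"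
proof -
  define r where "r = norm x"
  define L where "L = \<rho> - ln r"
  have r: "r > 0" and L: "L > 0"
    using assms ln_norm_le_0 \<rho> by (simp_all add: r_def L_def del: ln_le_zero_iff)
  define d where "d = q * (r powr (- p - 1) * L powr (- q - 1)) - p * (r powr (- p - 1) * L powr (- q))"
  have "((\<lambda>r. r powr (- p) * (\<rho> - ln r) powr (- q)) has_real_derivative d) (at r)"
    using r L unfolding d_def L_def
    by (auto intro!: derivative_eq_intros simp: L_def powr_diff divide_simps algebra_simps)
  then have D: "((\<lambda>r. r powr (- p) * (\<rho> - ln r) powr (- q)) has_derivative (\<lambda>h. d * h)) (at (norm x))"
    by (simp add: has_field_derivative_def r_def)
  have "(norm has_derivative (\<lambda>h. (x \<bullet> h) / r)) (at x)"
    using has_derivative_norm[OF assms] by (simp add: r_def sgn_div_norm inner_commute divide_inverse mult.commute)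
  from has_derivative_compose[OF this D]
  have "(log_power \<rho> p q has_derivative (\<lambda>h. d * ((x \<bullet> h) / r))) (at x)"
    unfolding log_power_def[abs_def] .
  moreover have "d / r = log_power_slope \<rho> p q x"
  proof -
    have "r powr (- p - 1) / r = r powr (- (p + 2))"
      using r powr_diff[of r "- p - 1" 1] by (simp add: algebra_simps)
    moreover have "d / r = q * (r powr (- p - 1) / r * L powr (- (q + 1))) - p * (r powr (- p - 1) / r * L powr (- q))"
      by (simp add: d_def diff_divide_distrib)
    ultimately show ?thesis
      by (simp only: log_power_slope_def log_power_def r_def[symmetric] L_def[symmetric])
  qed
  then have "d * ((x \<bullet> h) / r) = log_power_slope \<rho> p q x * (x \<bullet> h)" for h
    by (metis times_divide_eq_left times_divide_eq_right)
  ultimately show ?thesis by simp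
qed

end

lemma log_power_measurable [measurable]:
  "log_power \<rho> p q \<in> borel_measurable borel"
  "log_power_slope \<rho> p q \<in> borel_measurable borel"
  unfolding log_power_def[abs_def] log_power_slope_def[abs_def] by measurable

lemma log_power_continuous:
  assumes "\<rho> \<ge> 1"
  shows "continuous_on (ball 0 1 - {0::'a::real_inner}) (log_power \<rho> p q)"
proof (rule continuous_at_imp_continuous_on, rule ballI)
  fix x :: 'a assume "x \<in> ball 0 1 - {0}"
  then show "isCont (log_power \<rho> p q) x"
    using assms by (intro has_derivative_continuous[OF log_power_has_derivative]) auto
qed

text \<open>On the shell where \<open>- ln |x|\<close> lies between \<open>k\<close> and \<open>k + 1\<close>, the function is at most
  \<open>exp (n * (k + 1)) * (k + 1) powr - q\<close>, while the ball that contains the shell has volume proportional to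
  \<open>exp (- n * k)\<close>. The exponentials cancel up to a constant and leave the convergent series of
  \<open>(k + 1) powr - q\<close>.\<close>

lemma integrable_log_power:
  assumes "q > 1"
  shows "integrable (lebesgue_on (ball 0 1)) (log_power 1 (real CARD('n)) q :: real^'n::finite \<Rightarrow> real)"
proof -
  let ?n = "real CARD('n)"
  let ?W = "log_power 1 ?n q :: real^'n \<Rightarrow> real"
  define V where "V = unit_ball_vol ?n"
  have V: "V \<ge> 0" by (simp add: V_def)
  define c where "c k = exp (?n * (real k + 1)) * (real k + 1) powr (- q)" for k :: nat
  define B where "B k = cball (0::real^'n) (exp (- real k))" for k :: nat
  have c: "c k \<ge> 0" for k by (simp add: c_def)
  have bound: "indicator (ball 0 1) x * ennreal (?W x) \<le> (\<Sum>k. ennreal (c k) * indicator (B k) x)" for x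
  proof (cases "x \<in> ball 0 1 \<and> x \<noteq> 0")
    case True
    define t where "t = - ln (norm x)"
    define k where "k = nat \<lfloor>t\<rfloor>"
    have t: "t \<ge> 0" using True by (simp add: t_def)
    have k: "real k \<le> t" "t \<le> real k + 1" using t by (auto simp: k_def)
    have r: "norm x = exp (- t)" using True by (simp add: t_def)
    have "?W x = exp (?n * t) * (1 + t) powr (- q)"
      unfolding log_power_def by (simp add: r powr_def)
    also have "\<dots> \<le> c k" unfolding c_def
      using k t assms by (intro mult_mono powr_mono2') auto
    finally have "ennreal (?W x) \<le> ennreal (c k)" by (rule ennreal_leI)
    moreover have "x \<in> B k" using k by (simp add: B_def r)
    ultimately have "indicator (ball 0 1) x * ennreal (?W x) \<le> (\<Sum>k\<in>{k}. ennreal (c k) * indicator (B k) x)"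
      using True by simp
    also have "\<dots> \<le> (\<Sum>k. ennreal (c k) * indicator (B k) x)"
      by (rule sum_le_suminf) auto
    finally show ?thesis .
  qed (auto simp: indicator_def)
  have vol: "ennreal (c k) * emeasure lborel (B k) = ennreal (V * exp ?n * real (Suc k) powr (- q))" for k
  proof -
    have "emeasure lborel (B k) = ennreal (V * exp (- real k) ^ CARD('n))"
      unfolding B_def by (subst emeasure_cball) (auto simp: V_def)
    moreover have "exp (- real k) ^ CARD('n) = exp (- (?n * real k))"
      by (simp flip: exp_of_nat_mult)
    ultimately have "ennreal (c k) * emeasure lborel (B k)
        = ennreal (exp (?n * (real k + 1)) * real (Suc k) powr (- q) * (V * exp (- (?n * real k))))"
      using c[of k] V by (simp add: ennreal_mult' c_def add.commute)
    also have "exp (?n * (real k + 1)) * real (Suc k) powr (- q) * (V * exp (- (?n * real k)))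
        = V * (exp (?n * (real k + 1)) * exp (- (?n * real k))) * real (Suc k) powr (- q)"
      by (simp only: mult_ac)
    also have "exp (?n * (real k + 1)) * exp (- (?n * real k)) = exp ?n"
      by (simp add: algebra_simps flip: exp_add)
    finally show ?thesis .
  qed
  have summ: "summable (\<lambda>k. V * exp ?n * real (Suc k) powr (- q))"
    using assms by (intro summable_mult) (subst summable_Suc_iff, simp add: summable_real_powr_iff)
  have Bm [measurable]: "B k \<in> sets borel" for k by (simp add: B_def)
  have "(\<integral>\<^sup>+x. indicator (ball 0 1) x * ennreal (?W x) \<partial>lborel)
      \<le> (\<integral>\<^sup>+x. (\<Sum>k. ennreal (c k) * indicator (B k) x) \<partial>lborel)"
    by (intro nn_integral_mono bound)
  also have "\<dots> = (\<Sum>k. \<integral>\<^sup>+x. ennreal (c k) * indicator (B k) x \<partial>lborel)"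
    by (rule nn_integral_suminf) measurable
  also have "\<dots> = (\<Sum>k. ennreal (V * exp ?n * real (Suc k) powr (- q)))"
    by (intro suminf_cong) (simp add: nn_integral_cmult vol)
  also have "\<dots> = ennreal (\<Sum>k. V * exp ?n * real (Suc k) powr (- q))"
    using summ V by (intro suminf_ennreal2) auto
  also have "\<dots> < \<infinity>" by simp
  finally have fin: "(\<integral>\<^sup>+x. indicator (ball 0 1) x * ennreal (?W x) \<partial>lborel) < \<infinity>" .
  have meas: "(\<lambda>x. indicator (ball 0 1) x *\<^sub>R ?W x) \<in> borel_measurable lborel"
    using log_power_measurable(1)
    by (intro borel_measurable_scaleR borel_measurable_indicator) auto
  have "integrable lborel (\<lambda>x. indicator (ball 0 1) x *\<^sub>R ?W x)"
  proof (rule integrableI_bounded[OF meas])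
    have "(\<integral>\<^sup>+x. ennreal (norm (indicator (ball 0 1) x *\<^sub>R ?W x)) \<partial>lborel) = (\<integral>\<^sup>+x. indicator (ball 0 1) x * ennreal (?W x) \<partial>lborel)"
      by (intro nn_integral_cong) (auto simp: indicator_def)
    then show "(\<integral>\<^sup>+x. ennreal (norm (indicator (ball 0 1) x *\<^sub>R ?W x)) \<partial>lborel) < \<infinity>" using fin by simp
  qed
  then have "integrable lebesgue (\<lambda>x. indicator (ball 0 1) x *\<^sub>R ?W x)"
    unfolding integrable_completion[OF meas] .
  moreover have "ball (0::real^'n) 1 \<inter> space lebesgue \<in> sets lebesgue" by simp
  ultimately show ?thesis by (simp only: integrable_restrict_space)
qed

section \<open>Derivatives and Laplacians of the profiles\<close>

text \<open>The factor of \<open>x\<close> in the gradient of \<open>log_power_slope\<close>.\<close>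

definition log_power_slope2 :: "real \<Rightarrow> real \<Rightarrow> real \<Rightarrow> 'a::real_inner \<Rightarrow> real" where
  "log_power_slope2 \<rho> p q x =
     q * log_power_slope \<rho> (p + 2) (q + 1) x - p * log_power_slope \<rho> (p + 2) q x"

lemma log_power_slope_has_derivative:
  fixes x :: "'a::real_inner"
  assumes "norm x < 1" "\<rho> \<ge> 1" "x \<noteq> 0"
  shows "(log_power_slope \<rho> p q has_derivative (\<lambda>h. log_power_slope2 \<rho> p q x * (x \<bullet> h))) (at x)"
proof -
  have "((\<lambda>x. q * log_power \<rho> (p + 2) (q + 1) x - p * log_power \<rho> (p + 2) q x) has_derivative
      (\<lambda>h. q * (log_power_slope \<rho> (p + 2) (q + 1) x * (x \<bullet> h)) - p * (log_power_slope \<rho> (p + 2) q x * (x \<bullet> h)))) (at x)"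
    by (intro has_derivative_diff has_derivative_mult_right log_power_has_derivative assms)
  moreover have "log_power_slope \<rho> p q = (\<lambda>x::'a. q * log_power \<rho> (p + 2) (q + 1) x - p * log_power \<rho> (p + 2) q x)"
    by (rule ext) (rule log_power_slope_def)
  ultimately show ?thesis by (simp add: log_power_slope2_def left_diff_distrib mult.assoc)
qed

lemma log_power_slope_continuous:
  assumes "\<rho> \<ge> 1"
  shows "continuous_on (ball 0 1 - {0::'a::real_inner}) (log_power_slope \<rho> p q)"
    and "continuous_on (ball 0 1 - {0::'a::real_inner}) (log_power_slope2 \<rho> p q)"
  unfolding log_power_slope_def[abs_def] log_power_slope2_def[abs_def]
  by (intro continuous_intros log_power_continuous assms)+

lemma log_power_slope2_measurable [measurable]:
  "log_power_slope2 \<rho> p q \<in> borel_measurable borel"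
  unfolding log_power_slope2_def[abs_def]
  by (intro borel_measurable_diff borel_measurable_times log_power_measurable borel_measurable_const)

lemma log_power_slope_bound:
  assumes "norm x < 1" "\<rho> \<ge> 1"
  shows "\<bar>log_power_slope \<rho> p q x\<bar> \<le> (\<bar>p\<bar> + \<bar>q\<bar>) * log_power \<rho> (p + 2) q x"
proof -
  have "\<bar>q * log_power \<rho> (p + 2) (q + 1) x\<bar> \<le> \<bar>q\<bar> * log_power \<rho> (p + 2) q x"
    unfolding abs_mult by (intro mult_left_mono) (auto intro: log_power_mono[OF assms])
  moreover have "\<bar>p * log_power \<rho> (p + 2) q x\<bar> = \<bar>p\<bar> * log_power \<rho> (p + 2) q x"
    by (simp add: abs_mult)
  ultimately show ?thesis unfolding log_power_slope_def distrib_right by linarith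
qed

lemma log_power_slope2_bound:
  assumes "norm x < 1" "\<rho> \<ge> 1"
  shows "\<bar>log_power_slope2 \<rho> p q x\<bar> \<le> (\<bar>p\<bar> + \<bar>q\<bar>) * (\<bar>p\<bar> + \<bar>q\<bar> + 3) * log_power \<rho> (p + 4) q x"
proof -
  let ?c = "\<bar>p\<bar> + \<bar>q\<bar> + 3" and ?E = "log_power \<rho> (p + 4) q x"
  have "\<bar>log_power_slope \<rho> (p + 2) (q + 1) x\<bar> \<le> (\<bar>p + 2\<bar> + \<bar>q + 1\<bar>) * log_power \<rho> (p + 4) (q + 1) x"
    using log_power_slope_bound[OF assms, of "p + 2" "q + 1"] by (simp add: add.assoc)
  also have "\<dots> \<le> ?c * ?E"
    by (intro mult_mono log_power_mono[OF assms]) auto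
  finally have 1: "\<bar>q * log_power_slope \<rho> (p + 2) (q + 1) x\<bar> \<le> \<bar>q\<bar> * (?c * ?E)"
    unfolding abs_mult by (intro mult_left_mono) auto
  have "\<bar>log_power_slope \<rho> (p + 2) q x\<bar> \<le> (\<bar>p + 2\<bar> + \<bar>q\<bar>) * ?E"
    using log_power_slope_bound[OF assms, of "p + 2" q] by (simp add: add.assoc)
  also have "\<dots> \<le> ?c * ?E" by (intro mult_mono) auto
  finally have 2: "\<bar>p * log_power_slope \<rho> (p + 2) q x\<bar> \<le> \<bar>p\<bar> * (?c * ?E)"
    unfolding abs_mult by (intro mult_left_mono) auto
  have "\<bar>log_power_slope2 \<rho> p q x\<bar> \<le> \<bar>q\<bar> * (?c * ?E) + \<bar>p\<bar> * (?c * ?E)"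
    unfolding log_power_slope2_def by (rule order_trans[OF abs_triangle_ineq4 add_mono[OF 1 2]])
  also have "\<dots> = (\<bar>p\<bar> + \<bar>q\<bar>) * ?c * ?E" by (simp only: distrib_right mult.assoc add.commute)
  finally show ?thesis .
qed

text \<open>If \<open>Y\<close> is a harmonic polynomial, homogeneous of degree \<open>d\<close>, and \<open>\<kappa> = n + 2 * d\<close>, then the left-hand side times
  \<open>Y\<close> is the Laplacian of \<open>Y\<close> times \<open>log_power \<rho> p q\<close>. The cases \<open>d = 0\<close> and
  \<open>d = 1\<close> are used. The leading coefficient vanishes for \<open>p = \<kappa> - 2\<close>, the exponent of the
  singular harmonic function.\<close>

lemma laplacian_log_power:
  "\<kappa> * log_power_slope \<rho> p q x + (x \<bullet> x) * log_power_slope2 \<rho> p q x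
   = p * (p + 2 - \<kappa>) * log_power \<rho> (p + 2) q x
     + q * (\<kappa> - 2 * p - 2) * log_power \<rho> (p + 2) (q + 1) x
     + q * (q + 1) * log_power \<rho> (p + 2) (q + 2) x"
proof -
  have "(x \<bullet> x) * log_power_slope2 \<rho> p q x =
      q * ((q + 1) * ((x \<bullet> x) * log_power \<rho> (p + 2 + 2) (q + 1 + 1) x) - (p + 2) * ((x \<bullet> x) * log_power \<rho> (p + 2 + 2) (q + 1) x))
      - p * (q * ((x \<bullet> x) * log_power \<rho> (p + 2 + 2) (q + 1) x) - (p + 2) * ((x \<bullet> x) * log_power \<rho> (p + 2 + 2) q x))"
    unfolding log_power_slope2_def log_power_slope_def by (simp only: algebra_simps)
  then show ?thesis
    unfolding inner_log_power by (simp add: log_power_slope_def algebra_simps)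
qed

lemma integrable_of_log_power_bound:
  fixes f :: "real^'n::finite \<Rightarrow> 'b::euclidean_space"
  assumes f: "f \<in> borel_measurable borel" and \<rho>: "\<rho> \<ge> 1" and q: "q > 1"
    and le: "\<And>x. norm x < 1 \<Longrightarrow> x \<noteq> 0 \<Longrightarrow> norm (f x) \<le> C * log_power \<rho> (real CARD('n)) q x"
  shows "integrable (lebesgue_on (ball 0 1)) f"
proof (rule Bochner_Integration.integrable_bound)
  show "integrable (lebesgue_on (ball 0 1)) (\<lambda>x::real^'n. \<bar>C\<bar> * log_power 1 (real CARD('n)) q x)"
    using integrable_log_power[OF q, where 'n = 'n] by simp
  show "f \<in> borel_measurable (lebesgue_on (ball 0 1))" by (rule borel_imp_lebesgue_on[OF f])
  have "norm (f x) \<le> norm (\<bar>C\<bar> * log_power 1 (real CARD('n)) q x)" if "norm x < 1" "x \<noteq> 0" for x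
  proof -
    have "norm (f x) \<le> \<bar>C\<bar> * log_power \<rho> (real CARD('n)) q x"
      using le[OF that] mult_right_mono[OF abs_ge_self[of C] log_power_nonneg[of \<rho> "real CARD('n)" q x]] by linarith
    also have "\<dots> \<le> \<bar>C\<bar> * log_power 1 (real CARD('n)) q x"
      using q by (intro mult_left_mono log_power_le_shift_1 that \<rho>) auto
    finally show ?thesis by simp
  qed
  moreover have "AE x in lebesgue_on (ball 0 1). x \<noteq> (0::real^'n)" by (rule AE_lebesgue_on_neq) simp
  moreover have "AE x in lebesgue_on (ball 0 1). norm (x::real^'n) < 1"
    by (rule AE_I2) (simp add: space_restrict_space)
  ultimately show "AE x in lebesgue_on (ball 0 1). norm (f x) \<le> norm (\<bar>C\<bar> * log_power 1 (real CARD('n)) q x)"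
    by (auto elim!: eventually_elim2)
qed

text \<open>Two applications of \<open>distr_partial_punctured\<close>: to \<open>v\<close> with the test function \<open>partial j \<phi>\<close>, and to
  \<open>G j\<close> with \<open>\<phi>\<close>.\<close>

lemma distr_laplacian_punctured:
  fixes v :: "real^'n::finite \<Rightarrow> real"
  assumes U: "open U"
    and v: "\<And>x. x \<in> U - {0} \<Longrightarrow> v differentiable (at x)"
    and G: "\<And>x j. x \<in> U - {0} \<Longrightarrow> partial j v x = G j x"
      "\<And>x j. x \<in> U - {0} \<Longrightarrow> G j differentiable (at x)"
    and H: "\<And>x j. x \<in> U - {0} \<Longrightarrow> partial j (G j) x = H j x"
      "\<And>j. continuous_on (U - {0}) (H j)"
    and int: "integrable (lebesgue_on U) (\<lambda>x. v x / norm x)" "\<And>j. integrable (lebesgue_on U) (G j)"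
      "\<And>j. integrable (lebesgue_on U) (\<lambda>x. G j x / norm x)" "\<And>j. integrable (lebesgue_on U) (H j)"
    and \<phi>: "\<phi> \<in> test_functions U"
  shows "distr_partial j (regular_distr U v) \<phi> = regular_distr U (G j) \<phi> \<and>
    distr_laplacian (regular_distr U v) \<phi> = regular_distr U (\<lambda>x. \<Sum>j\<in>UNIV. H j x) \<phi>"
proof -
  have contG: "continuous_on (U - {0}) (G j)" for j
    using G(2) by (intro continuous_at_imp_continuous_on) (auto intro: differentiable_imp_continuous_within)
  have 1: "distr_partial j (regular_distr U v) \<psi> = regular_distr U (G j) \<psi>" if "\<psi> \<in> test_functions U" for j \<psi>
    using U v G(1) contG int(1,2) that by (rule distr_partial_punctured)
  have 2: "distr_partial j (distr_partial j (regular_distr U v)) \<phi> = regular_distr U (H j) \<phi>" for j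
  proof -
    have "distr_partial j (distr_partial j (regular_distr U v)) \<phi> = - distr_partial j (regular_distr U v) (partial j \<phi>)"
      by (simp add: distr_partial_def)
    also have "\<dots> = distr_partial j (regular_distr U (G j)) \<phi>"
      by (subst 1) (auto simp: distr_partial_def test_function_C1(4)[OF \<phi>])
    also have "\<dots> = regular_distr U (H j) \<phi>"
      using U G(2) H int(3,4) \<phi> by (rule distr_partial_punctured)
    finally show ?thesis .
  qed
  obtain M where M: "\<And>x. \<bar>\<phi> x\<bar> \<le> M" by (rule test_function_bounded[OF \<phi>]) (rule that)
  have "integrable (lebesgue_on U) (\<lambda>x. H j x * \<phi> x)" for j
    using M by (intro integrable_mult_bounded int(4) borel_imp_lebesgue_on
        borel_measurable_continuous_onI test_function_C1(3)[OF \<phi>])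
  then have "distr_laplacian (regular_distr U v) \<phi> = regular_distr U (\<lambda>x. \<Sum>j\<in>UNIV. H j x) \<phi>"
    unfolding distr_laplacian_def 2 regular_distr_def by (simp add: sum_distrib_right)
  then show ?thesis using 1[OF \<phi>] by simp
qed

lemma log_power_div_norm:
  "x \<noteq> 0 \<Longrightarrow> log_power \<rho> p q x / norm x = log_power \<rho> (p + 1) q x"
  using norm_log_power[of x \<rho> p q] by (simp add: divide_eq_eq mult.commute)

section \<open>Distributional derivatives of the components\<close>

text \<open>Each factor \<open>x $ j\<close> lowers the order of the singularity by one, and each division by the norm
  raises it by one; the bounds on all derivatives below are counted in this way.\<close>

lemma component_mult_log_power_bound:
  fixes x :: "real^'n::finite"
  assumes "\<bar>y\<bar> \<le> c * log_power \<rho> (p + 1) q x"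
  shows "\<bar>x $ j * y\<bar> \<le> c * log_power \<rho> p q x"
proof -
  have "\<bar>x $ j * y\<bar> \<le> norm x * (c * log_power \<rho> (p + 1) q x)"
    unfolding abs_mult by (intro mult_mono assms) (auto simp: component_le_norm_cart)
  also have "\<dots> = c * (norm x * log_power \<rho> (p + 1) q x)" by (simp only: mult_ac)
  finally show ?thesis unfolding norm_log_power .
qed

lemma axis_nth_if: "axis j c $ a = (if a = j then c else 0)"
  by (simp add: axis_def)

lemma component_has_derivative:
  "((\<lambda>x::real^'n::finite. x $ j) has_derivative (\<lambda>h. h $ j)) (at x)"
  by (rule bounded_linear_imp_has_derivative[OF bounded_linear_vec_nth])

lemma div_norm_log_power_bound:
  assumes "x \<noteq> 0" "\<bar>y\<bar> \<le> c * log_power \<rho> p q x"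
  shows "\<bar>y / norm x\<bar> \<le> c * log_power \<rho> (p + 1) q x"
proof -
  have "\<bar>y / norm x\<bar> \<le> c * log_power \<rho> p q x / norm x"
    using assms by (simp add: divide_right_mono)
  then show ?thesis using log_power_div_norm[OF assms(1), of \<rho> p q] by (simp flip: times_divide_eq_right)
qed

context
  fixes \<rho> p q :: real
  assumes \<rho>: "\<rho> \<ge> 1" and q: "q > 1"
begin

lemma integrable_of_lower_order_bound:
  fixes f :: "real^'n::finite \<Rightarrow> real"
  assumes "f \<in> borel_measurable borel" "p' \<le> real CARD('n)" "c \<ge> 0"
    "\<And>x. norm x < 1 \<Longrightarrow> x \<noteq> 0 \<Longrightarrow> \<bar>f x\<bar> \<le> c * log_power \<rho> p' q x"
  shows "integrable (lebesgue_on (ball 0 1)) f"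
proof (rule integrable_of_log_power_bound[OF assms(1) \<rho> q])
  fix x :: "real^'n" assume x: "norm x < 1" "x \<noteq> 0"
  have "c * log_power \<rho> p' q x \<le> c * log_power \<rho> (real CARD('n)) q x"
    by (intro mult_left_mono log_power_mono x \<rho> assms) auto
  then show "norm (f x) \<le> c * log_power \<rho> (real CARD('n)) q x" using assms(4)[OF x] by simp
qed

private abbreviation "c1 \<equiv> \<bar>p\<bar> + \<bar>q\<bar>"
private abbreviation "c2 \<equiv> c1 * (c1 + 3)"

lemma slope_bounds:
  fixes x :: "real^'n::finite"
  assumes x: "norm x < 1"
  shows "\<bar>log_power_slope \<rho> p q x\<bar> \<le> c1 * log_power \<rho> (p + 2) q x"
    "\<bar>x $ i * log_power_slope \<rho> p q x\<bar> \<le> c1 * log_power \<rho> (p + 1) q x"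
    "\<bar>x $ i * (x $ j * log_power_slope \<rho> p q x)\<bar> \<le> c1 * log_power \<rho> p q x"
    "\<bar>x $ i * (x $ j * log_power_slope2 \<rho> p q x)\<bar> \<le> c2 * log_power \<rho> (p + 2) q x"
    "\<bar>x $ k * (x $ i * (x $ j * log_power_slope2 \<rho> p q x))\<bar> \<le> c2 * log_power \<rho> (p + 1) q x"
proof -
  note s = log_power_slope_bound[OF x \<rho>, of p q]
  note s2 = log_power_slope2_bound[OF x \<rho>, of p q]
  show "\<bar>log_power_slope \<rho> p q x\<bar> \<le> c1 * log_power \<rho> (p + 2) q x" by (rule s)
  show s1: "\<bar>x $ i * log_power_slope \<rho> p q x\<bar> \<le> c1 * log_power \<rho> (p + 1) q x" for i
    by (rule component_mult_log_power_bound) (use s in \<open>simp add: add.assoc\<close>)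
  show "\<bar>x $ i * (x $ j * log_power_slope \<rho> p q x)\<bar> \<le> c1 * log_power \<rho> p q x"
    by (rule component_mult_log_power_bound[OF s1])
  have "\<bar>x $ j * log_power_slope2 \<rho> p q x\<bar> \<le> c2 * log_power \<rho> (p + 3) q x"
    by (rule component_mult_log_power_bound[where p = "p + 3"]) (use s2 in \<open>simp add: add.assoc\<close>)
  then show s3: "\<bar>x $ i * (x $ j * log_power_slope2 \<rho> p q x)\<bar> \<le> c2 * log_power \<rho> (p + 2) q x"
    by (intro component_mult_log_power_bound[where p = "p + 2"]) (simp add: add.assoc)
  then show "\<bar>x $ k * (x $ i * (x $ j * log_power_slope2 \<rho> p q x))\<bar> \<le> c2 * log_power \<rho> (p + 1) q x"
    by (intro component_mult_log_power_bound[where p = "p + 1"]) (simp add: add.assoc)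
qed

text \<open>The condition on \<open>p\<close> keeps the second derivatives, whose singularity has order \<open>p + 2\<close>,
  integrable at 0.\<close>

lemma distr_log_power:
  fixes \<phi> :: "real^'n::finite \<Rightarrow> real"
  assumes p: "p \<le> real CARD('n) - 2" and \<phi>: "\<phi> \<in> test_functions (ball 0 1)"
  shows "distr_partial j (regular_distr (ball 0 1) (log_power \<rho> p q)) \<phi>
      = regular_distr (ball 0 1) (\<lambda>x. x $ j * log_power_slope \<rho> p q x) \<phi>"
    and "distr_laplacian (regular_distr (ball 0 1) (log_power \<rho> p q)) \<phi>
      = regular_distr (ball 0 1) (\<lambda>x. real CARD('n) * log_power_slope \<rho> p q x
          + (x \<bullet> x) * log_power_slope2 \<rho> p q x) \<phi>"
proof -
  let ?B = "ball (0::real^'n) 1" and ?v = "log_power \<rho> p q :: real^'n \<Rightarrow> real"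
  define G where "G j x = x $ j * log_power_slope \<rho> p q x" for j and x :: "real^'n"
  define H where "H j x = log_power_slope \<rho> p q x + x $ j * (x $ j * log_power_slope2 \<rho> p q x)"
    for j and x :: "real^'n"
  have v': "(?v has_derivative (\<lambda>h. log_power_slope \<rho> p q x * (x \<bullet> h))) (at x)" if "x \<in> ?B - {0}" for x
    using that \<rho> by (intro log_power_has_derivative) auto
  have G': "(G j has_derivative (\<lambda>h. x $ j * (log_power_slope2 \<rho> p q x * (x \<bullet> h))
      + h $ j * log_power_slope \<rho> p q x)) (at x)" if "x \<in> ?B - {0}" for x j
    unfolding G_def[abs_def] using that \<rho>
    by (intro has_derivative_mult component_has_derivative log_power_slope_has_derivative) auto
  have G: "G j \<in> borel_measurable borel" for j unfolding G_def[abs_def] by measurable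
  have H: "H j \<in> borel_measurable borel" for j unfolding H_def[abs_def] by measurable
  have Hb: "\<bar>H j x\<bar> \<le> (c1 + c2) * log_power \<rho> (p + 2) q x" if "norm x < 1" for x j
    using slope_bounds(1)[OF that] slope_bounds(4)[OF that, of j j]
    unfolding H_def distrib_right[of c1 c2] by linarith
  have "distr_partial j (regular_distr ?B ?v) \<phi> = regular_distr ?B (G j) \<phi> \<and>
      distr_laplacian (regular_distr ?B ?v) \<phi> = regular_distr ?B (\<lambda>x. \<Sum>j\<in>UNIV. H j x) \<phi>" for j
  proof (rule distr_laplacian_punctured[where G = G and H = H, OF _ _ _ _ _ _ _ _ _ _ \<phi>])
    show "?v differentiable at x" "G j differentiable at x" if "x \<in> ?B - {0}" for x j
      using differentiableI v'[OF that] G'[OF that] by blast+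
    show "partial j ?v x = G j x" if "x \<in> ?B - {0}" for x j
      by (subst partial_eqI[OF v'[OF that]]) (simp add: G_def inner_axis)
    show "partial j (G j) x = H j x" if "x \<in> ?B - {0}" for x j
      by (subst partial_eqI[OF G'[OF that]]) (simp add: H_def inner_axis)
    show "continuous_on (?B - {0}) (H j)" for j unfolding H_def[abs_def]
      by (intro continuous_intros log_power_slope_continuous \<rho>)
    show "integrable (lebesgue_on ?B) (\<lambda>x. ?v x / norm x)"
      by (rule integrable_of_lower_order_bound[of _ "p + 1" 1]) (use p in \<open>auto simp: log_power_div_norm\<close>)
    show "integrable (lebesgue_on ?B) (G j)" for j
      by (rule integrable_of_lower_order_bound[OF G, of "p + 1" c1]) (use p q slope_bounds(2) in \<open>auto simp: G_def\<close>)
    show "integrable (lebesgue_on ?B) (\<lambda>x. G j x / norm x)" for j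
    proof (rule integrable_of_lower_order_bound[of _ "p + 2" c1])
      show "\<bar>G j x / norm x\<bar> \<le> c1 * log_power \<rho> (p + 2) q x" if "norm x < 1" "x \<noteq> 0" for x
        using div_norm_log_power_bound[OF that(2) slope_bounds(2)[OF that(1), of j]] by (simp add: G_def add.assoc)
    qed (use p G in auto)
    show "integrable (lebesgue_on ?B) (H j)" for j
      by (rule integrable_of_lower_order_bound[OF H, of "p + 2" "c1 + c2"]) (use p q Hb in auto)
  qed simp_all
  moreover have "(\<Sum>j\<in>UNIV. H j x) = real CARD('n) * log_power_slope \<rho> p q x + (x \<bullet> x) * log_power_slope2 \<rho> p q x" for x
    by (simp add: H_def sum.distrib inner_vec_def sum_distrib_right mult.assoc)
  ultimately show "distr_partial j (regular_distr ?B ?v) \<phi> = regular_distr ?B (\<lambda>x. x $ j * log_power_slope \<rho> p q x) \<phi>"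
    "distr_laplacian (regular_distr ?B ?v) \<phi>
      = regular_distr ?B (\<lambda>x. real CARD('n) * log_power_slope \<rho> p q x + (x \<bullet> x) * log_power_slope2 \<rho> p q x) \<phi>"
    unfolding G_def by simp_all
qed

text \<open>The factor \<open>x $ a\<close> gains one order, so \<open>p\<close> may exceed the previous limit by one.\<close>

lemma distr_component_log_power:
  fixes \<phi> :: "real^'n::finite \<Rightarrow> real"
  assumes p: "p \<le> real CARD('n) - 1" and \<phi>: "\<phi> \<in> test_functions (ball 0 1)"
  shows "distr_partial j (regular_distr (ball 0 1) (\<lambda>x. x $ a * log_power \<rho> p q x)) \<phi>
      = regular_distr (ball 0 1) (\<lambda>x. (if a = j then log_power \<rho> p q x else 0)
          + x $ a * (x $ j * log_power_slope \<rho> p q x)) \<phi>"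
    and "distr_laplacian (regular_distr (ball 0 1) (\<lambda>x. x $ a * log_power \<rho> p q x)) \<phi>
      = regular_distr (ball 0 1) (\<lambda>x. x $ a * ((real CARD('n) + 2) * log_power_slope \<rho> p q x
          + (x \<bullet> x) * log_power_slope2 \<rho> p q x)) \<phi>"
proof -
  let ?B = "ball (0::real^'n) 1"
  define v where "v x = x $ a * log_power \<rho> p q x" for x :: "real^'n"
  define G where "G j x = (if a = j then log_power \<rho> p q x else 0)
          + x $ a * (x $ j * log_power_slope \<rho> p q x)" for j and x :: "real^'n"
  define H where "H j x = (if a = j then 2 * (x $ a * log_power_slope \<rho> p q x) else 0)
      + x $ a * log_power_slope \<rho> p q x + x $ a * (x $ j * (x $ j * log_power_slope2 \<rho> p q x))"
    for j and x :: "real^'n"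
  have v': "(v has_derivative (\<lambda>h. x $ a * (log_power_slope \<rho> p q x * (x \<bullet> h))
      + h $ a * log_power \<rho> p q x)) (at x)" if "x \<in> ?B - {0}" for x
    unfolding v_def[abs_def] using that \<rho>
    by (intro has_derivative_mult component_has_derivative log_power_has_derivative) auto
  have G': "(G j has_derivative (\<lambda>h. (if a = j then log_power_slope \<rho> p q x * (x \<bullet> h) else 0)
     + (x $ a * (x $ j * (log_power_slope2 \<rho> p q x * (x \<bullet> h)) + h $ j * log_power_slope \<rho> p q x)
        + h $ a * (x $ j * log_power_slope \<rho> p q x)))) (at x)" if "x \<in> ?B - {0}" for x j
  proof -
    have "((\<lambda>x. if a = j then log_power \<rho> p q x else 0) has_derivative
        (\<lambda>h. if a = j then log_power_slope \<rho> p q x * (x \<bullet> h) else 0)) (at x)"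
      using that \<rho> by (cases "a = j") (auto intro: log_power_has_derivative)
    then show ?thesis unfolding G_def[abs_def] using that \<rho>
      by (intro has_derivative_add has_derivative_mult component_has_derivative log_power_slope_has_derivative) auto
  qed
  have vm: "v \<in> borel_measurable borel" unfolding v_def[abs_def] by measurable
  have G: "G j \<in> borel_measurable borel" for j unfolding G_def[abs_def] by measurable
  have H: "H j \<in> borel_measurable borel" for j unfolding H_def[abs_def] by measurable
  have vb: "\<bar>v x\<bar> \<le> 1 * log_power \<rho> (p - 1) q x" for x
    unfolding v_def by (rule component_mult_log_power_bound) simp
  have Gb: "\<bar>G j x\<bar> \<le> (1 + c1) * log_power \<rho> p q x" if "norm x < 1" for x j
  proof -
    have "\<bar>G j x\<bar> \<le> \<bar>if a = j then log_power \<rho> p q x else 0\<bar> + \<bar>x $ a * (x $ j * log_power_slope \<rho> p q x)\<bar>"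
      unfolding G_def by (rule abs_triangle_ineq)
    also have "\<dots> \<le> 1 * log_power \<rho> p q x + c1 * log_power \<rho> p q x"
      by (intro add_mono slope_bounds that) simp
    finally show ?thesis by (simp only: distrib_right)
  qed
  have Hb: "\<bar>H j x\<bar> \<le> (3 * c1 + c2) * log_power \<rho> (p + 1) q x" if "norm x < 1" for x j
  proof -
    have "\<bar>H j x\<bar> \<le> 3 * \<bar>x $ a * log_power_slope \<rho> p q x\<bar> + \<bar>x $ a * (x $ j * (x $ j * log_power_slope2 \<rho> p q x))\<bar>"
      unfolding H_def by (cases "a = j") auto
    also have "\<dots> \<le> 3 * (c1 * log_power \<rho> (p + 1) q x) + c2 * log_power \<rho> (p + 1) q x"
      by (intro add_mono mult_left_mono slope_bounds that) simp
    finally show ?thesis by (simp only: distrib_right mult.assoc)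
  qed
  have "distr_partial j (regular_distr ?B v) \<phi> = regular_distr ?B (G j) \<phi> \<and>
      distr_laplacian (regular_distr ?B v) \<phi> = regular_distr ?B (\<lambda>x. \<Sum>j\<in>UNIV. H j x) \<phi>" for j
  proof (rule distr_laplacian_punctured[where G = G and H = H, OF _ _ _ _ _ _ _ _ _ _ \<phi>])
    show "v differentiable at x" "G j differentiable at x" if "x \<in> ?B - {0}" for x j
      using differentiableI v'[OF that] G'[OF that] by blast+
    show "partial j v x = G j x" if "x \<in> ?B - {0}" for x j
      by (subst partial_eqI[OF v'[OF that]]) (simp add: G_def inner_axis axis_nth_if)
    show "partial j (G j) x = H j x" if "x \<in> ?B - {0}" for x j
      by (subst partial_eqI[OF G'[OF that]]) (simp add: H_def inner_axis axis_nth_if algebra_simps)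
    show "continuous_on (?B - {0}) (H j)" for j unfolding H_def[abs_def]
      by (cases "a = j") (auto intro!: continuous_intros log_power_slope_continuous \<rho>)
    show "integrable (lebesgue_on ?B) (\<lambda>x. v x / norm x)"
    proof (rule integrable_of_lower_order_bound[of _ p 1])
      show "\<bar>v x / norm x\<bar> \<le> 1 * log_power \<rho> p q x" if "norm x < 1" "x \<noteq> 0" for x
        using div_norm_log_power_bound[OF that(2) vb] by simp
    qed (use p vm in auto)
    show "integrable (lebesgue_on ?B) (G j)" for j
      by (rule integrable_of_lower_order_bound[OF G, of p "1 + c1"]) (use p q Gb in auto)
    show "integrable (lebesgue_on ?B) (\<lambda>x. G j x / norm x)" for j
    proof (rule integrable_of_lower_order_bound[of _ "p + 1" "1 + c1"])
      show "\<bar>G j x / norm x\<bar> \<le> (1 + c1) * log_power \<rho> (p + 1) q x" if "norm x < 1" "x \<noteq> 0" for x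
        using div_norm_log_power_bound[OF that(2) Gb[OF that(1)]] .
    qed (use p G in auto)
    show "integrable (lebesgue_on ?B) (H j)" for j
      by (rule integrable_of_lower_order_bound[OF H, of "p + 1" "3 * c1 + c2"]) (use p q Hb in auto)
  qed simp_all
  moreover have "(\<Sum>j\<in>UNIV. H j x) = x $ a * ((real CARD('n) + 2) * log_power_slope \<rho> p q x
          + (x \<bullet> x) * log_power_slope2 \<rho> p q x)" for x
  proof -
    have "(\<Sum>j\<in>UNIV. H j x) = 2 * (x $ a * log_power_slope \<rho> p q x)
      + real CARD('n) * (x $ a * log_power_slope \<rho> p q x)
      + (\<Sum>j\<in>UNIV. x $ a * log_power_slope2 \<rho> p q x * (x $ j * x $ j))"
      unfolding H_def sum.distrib by (simp add: mult_ac)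
    also have "(\<Sum>j\<in>UNIV. x $ a * log_power_slope2 \<rho> p q x * (x $ j * x $ j))
        = x $ a * log_power_slope2 \<rho> p q x * (x \<bullet> x)"
      by (simp add: inner_vec_def sum_distrib_left)
    finally show ?thesis by (simp add: algebra_simps)
  qed
  ultimately show "distr_partial j (regular_distr ?B (\<lambda>x. x $ a * log_power \<rho> p q x)) \<phi>
      = regular_distr ?B (\<lambda>x. (if a = j then log_power \<rho> p q x else 0)
          + x $ a * (x $ j * log_power_slope \<rho> p q x)) \<phi>"
    "distr_laplacian (regular_distr ?B (\<lambda>x. x $ a * log_power \<rho> p q x)) \<phi>
      = regular_distr ?B (\<lambda>x. x $ a * ((real CARD('n) + 2) * log_power_slope \<rho> p q x
          + (x \<bullet> x) * log_power_slope2 \<rho> p q x)) \<phi>"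
    unfolding G_def v_def by simp_all
qed

end

section \<open>The map and the connection form\<close>

text \<open>The Laplacian of the component \<open>u\<^sup>0\<close> away from the origin.\<close>

definition laplacian_radial :: "real \<Rightarrow> real^'n::finite \<Rightarrow> real" where
  "laplacian_radial \<rho> x = real CARD('n) * log_power_slope \<rho> (real CARD('n) - 2) 2 x
     + (x \<bullet> x) * log_power_slope2 \<rho> (real CARD('n) - 2) 2 x"

text \<open>The Laplacian of the component \<open>u\<^sup>a\<close> is \<open>x\<^sub>a\<close> times this radial function.\<close>

definition laplacian_angular :: "real \<Rightarrow> real^'n::finite \<Rightarrow> real" where
  "laplacian_angular \<rho> x = (real CARD('n) + 2) * log_power_slope \<rho> (real CARD('n) - 1) (5/2) x
     + (x \<bullet> x) * log_power_slope2 \<rho> (real CARD('n) - 1) (5/2) x"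

text \<open>The index \<open>i0\<close> stands for 0 in the range \<open>0, \<dots>, n\<close> of the components, and \<open>s\<close> identifies the remaining
  indices with the coordinates. With an exponent \<open>c\<close> in place of \<open>5/2\<close>, the equations of the other
  rows ask for a form of size \<open>log_power \<rho> 1 (c - 2)\<close>, and that of the row \<open>i0\<close> for one of size
  \<open>log_power \<rho> 1 (3 - c)\<close>; the choice \<open>c = 5/2\<close> balances the two.\<close>

definition unbounded_map :: "real \<Rightarrow> 'm \<Rightarrow> ('m \<Rightarrow> 'n) \<Rightarrow> real^'n::finite \<Rightarrow> real^'m::finite" where
  "unbounded_map \<rho> i0 s x = (\<chi> i. if i = i0 then log_power \<rho> (real CARD('n) - 2) 2 x
     else x $ s i * log_power \<rho> (real CARD('n) - 1) (5/2) x)"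

definition unbounded_map_grad :: "real \<Rightarrow> 'm \<Rightarrow> ('m \<Rightarrow> 'n) \<Rightarrow> real^'n::finite \<Rightarrow> real^'n^'m::finite" where
  "unbounded_map_grad \<rho> i0 s x = (\<chi> i j. if i = i0 then x $ j * log_power_slope \<rho> (real CARD('n) - 2) 2 x
     else (if s i = j then log_power \<rho> (real CARD('n) - 1) (5/2) x else 0)
       + x $ s i * (x $ j * log_power_slope \<rho> (real CARD('n) - 1) (5/2) x))"

text \<open>The solution \<open>\<tau>\<close> of the equation \<open>- \<tau> * P * x\<^sub>a = - x\<^sub>a * S\<close> of the row \<open>a\<close>, where \<open>P x\<close> is the gradient of
  \<open>u\<^sup>0\<close> and \<open>x\<^sub>a * S\<close> the Laplacian of \<open>u\<^sup>a\<close>.\<close>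

definition radial_coeff :: "real \<Rightarrow> real^'n::finite \<Rightarrow> real" where
  "radial_coeff \<rho> x = laplacian_angular \<rho> x / log_power_slope \<rho> (real CARD('n) - 2) 2 x"

text \<open>The solution \<open>\<alpha>\<close> of the equation of the row 0, which after summation over \<open>a\<close> reads
  \<open>(n - 1) * E * \<alpha> + \<tau> * (E + |x|\<^sup>2 * Q) = - D\<close>. Here \<open>D\<close> is the Laplacian of \<open>u\<^sup>0\<close>, and
  \<open>E e\<^sub>a + x\<^sub>a Q x\<close> is the gradient of \<open>u\<^sup>a\<close>.\<close>

definition tangential_coeff :: "real \<Rightarrow> real^'n::finite \<Rightarrow> real" where
  "tangential_coeff \<rho> x = (- laplacian_radial \<rho> x - radial_coeff \<rho> x * (log_power \<rho> (real CARD('n) - 1) (5/2) x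
       + (x \<bullet> x) * log_power_slope \<rho> (real CARD('n) - 1) (5/2) x))
     / ((real CARD('n) - 1) * log_power \<rho> (real CARD('n) - 1) (5/2) x)"

text \<open>The covector \<open>\<alpha> e\<^sub>a + \<beta> x\<^sub>a x\<close> with \<open>\<beta> = (\<tau> - \<alpha>) / |x|\<^sup>2\<close>.\<close>

definition connection_entry :: "real \<Rightarrow> 'n \<Rightarrow> real^'n::finite \<Rightarrow> real^'n" where
  "connection_entry \<rho> a x = tangential_coeff \<rho> x *\<^sub>R axis a 1 + ((radial_coeff \<rho> x - tangential_coeff \<rho> x) / (x \<bullet> x) * x $ a) *\<^sub>R x"

definition connection :: "real \<Rightarrow> 'm \<Rightarrow> ('m \<Rightarrow> 'n) \<Rightarrow> real^'n::finite \<Rightarrow> real^'n^'m^'m::finite" where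
  "connection \<rho> i0 s x = (\<chi> i k. if i = i0 then (if k = i0 then 0 else connection_entry \<rho> (s k) x)
     else if k = i0 then - connection_entry \<rho> (s i) x else 0)"

lemma so_form_connection: "so_form (connection \<rho> i0 s x)"
  by (simp add: so_form_def connection_def)

context
  fixes x :: "real^'n::finite" and \<rho> :: real
  assumes n: "CARD('n) \<ge> 3" and \<rho>: "\<rho> \<ge> 4" and x: "norm x < 1" and x0: "x \<noteq> 0"
begin

private abbreviation "E \<equiv> \<lambda>p q. log_power \<rho> p q x"
private abbreviation "P \<equiv> log_power_slope \<rho> (real CARD('n) - 2) 2 x"
private abbreviation "Q \<equiv> log_power_slope \<rho> (real CARD('n) - 1) (5/2) x"

private lemma N3: "real CARD('n) \<ge> 3" using n by simp

private lemma E_pos: "0 < E p q"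
  by (rule log_power_pos) (use x x0 \<rho> in auto)

private lemma E_mono: "p \<le> p' \<Longrightarrow> q' \<le> q \<Longrightarrow> E p q \<le> E p' q'"
  by (rule log_power_mono) (use x \<rho> in auto)

text \<open>The leading coefficient \<open>n - 2\<close> is at least 1, and for \<open>\<rho> \<ge> 4\<close> the next term, with one more
  logarithm and coefficient 2, takes away at most one half. So the division by \<open>P\<close> is harmless.\<close>

lemma radial_slope_lower_bound: "E (real CARD('n)) 2 / 2 \<le> - P"
proof -
  have "E (real CARD('n)) 3 \<le> \<rho> powr (- 1) * E (real CARD('n)) 2"
    using log_power_le_scaled[of x \<rho> 1 "real CARD('n)" 2] x \<rho> by simp
  also have "\<dots> \<le> 1/4 * E (real CARD('n)) 2"
    using \<rho> E_pos[of "real CARD('n)" 2] by (intro mult_right_mono) (auto simp: powr_minus divide_simps)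
  finally have "E (real CARD('n)) 3 \<le> E (real CARD('n)) 2 / 4" by simp
  moreover have "1 * E (real CARD('n)) 2 \<le> (real CARD('n) - 2) * E (real CARD('n)) 2"
    using N3 E_pos[of "real CARD('n)" 2] by (intro mult_right_mono) auto
  ultimately show ?thesis unfolding log_power_slope_def by simp
qed

text \<open>Harmonicity of \<open>|x| powr (2 - n)\<close> removes the term with \<open>E n 2\<close> and so gains a logarithm.\<close>

lemma laplacian_radial_bound: "\<bar>laplacian_radial \<rho> x\<bar> \<le> 3 * real CARD('n) * E (real CARD('n)) 3"
proof -
  have eq: "laplacian_radial \<rho> x = 6 * E (real CARD('n)) 4 - 2 * ((real CARD('n) - 2) * E (real CARD('n)) 3)"
    unfolding laplacian_radial_def laplacian_log_power by (simp add: algebra_simps)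
  have "0 \<le> (real CARD('n) - 2) * E (real CARD('n)) 3"
    "3 * E (real CARD('n)) 3 \<le> real CARD('n) * E (real CARD('n)) 3"
    using N3 E_pos[of "real CARD('n)" 3] by (auto intro!: mult_right_mono)
  moreover have "E (real CARD('n)) 4 \<le> E (real CARD('n)) 3" by (rule E_mono) auto
  moreover have "0 < E (real CARD('n)) 4" "0 < E (real CARD('n)) 3" by (rule E_pos)+
  ultimately show ?thesis unfolding eq left_diff_distrib right_diff_distrib mult.assoc by linarith
qed

lemma laplacian_angular_bound: "\<bar>laplacian_angular \<rho> x\<bar> \<le> 5 * real CARD('n) * E (real CARD('n) + 1) (5/2)"
proof -
  let ?A = "E (real CARD('n) + 1) (5/2)" and ?B = "E (real CARD('n) + 1) (7/2)" and ?C = "E (real CARD('n) + 1) (9/2)"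
  have eq: "laplacian_angular \<rho> x = 35/4 * ?C - (real CARD('n) - 1) * ?A - 5/2 * ((real CARD('n) - 2) * ?B)"
    unfolding laplacian_angular_def laplacian_log_power by (simp add: field_simps)
  have pos: "0 < ?A" "0 < ?B" "0 < ?C" by (rule E_pos)+
  have le: "?C \<le> ?A" "?B \<le> ?A" by (rule E_mono; simp)+
  have "(real CARD('n) - 2) * ?B \<le> (real CARD('n) - 2) * ?A" "0 \<le> (real CARD('n) - 2) * ?B" "0 \<le> (real CARD('n) - 1) * ?A" "3 * ?A \<le> real CARD('n) * ?A"
    using N3 pos le by (auto intro!: mult_right_mono mult_left_mono)
  with le pos show ?thesis unfolding eq left_diff_distrib right_diff_distrib mult.assoc by linarith
qed

lemma angular_gradient_bound: "\<bar>E (real CARD('n) - 1) (5/2) + (x \<bullet> x) * Q\<bar> \<le> 2 * real CARD('n) * E (real CARD('n) - 1) (5/2)"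
proof -
  let ?A = "E (real CARD('n) - 1) (5/2)" and ?B = "E (real CARD('n) - 1) (7/2)"
  have "(x \<bullet> x) * Q = 5/2 * ((x \<bullet> x) * E (real CARD('n) - 1 + 2) (7/2)) - (real CARD('n) - 1) * ((x \<bullet> x) * E (real CARD('n) - 1 + 2) (5/2))"
    by (simp add: log_power_slope_def algebra_simps)
  then have eq: "(x \<bullet> x) * Q = 5/2 * ?B - (real CARD('n) - 1) * ?A" unfolding inner_log_power .
  have pos: "0 < ?A" "0 < ?B" by (rule E_pos)+
  have le: "?B \<le> ?A" by (rule E_mono; simp)
  have "3 * ?A \<le> real CARD('n) * ?A" using N3 pos by (auto intro!: mult_right_mono)
  with le pos show ?thesis unfolding eq left_diff_distrib right_diff_distrib mult.assoc by linarith
qed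

lemma radial_coeff_bound: "\<bar>radial_coeff \<rho> x\<bar> \<le> 10 * real CARD('n) * E 1 (1/2)"
proof -
  have P: "E (real CARD('n)) 2 / 2 \<le> \<bar>P\<bar>" using radial_slope_lower_bound by linarith
  have "\<bar>radial_coeff \<rho> x\<bar> = \<bar>laplacian_angular \<rho> x\<bar> / \<bar>P\<bar>" by (simp add: radial_coeff_def abs_divide)
  also have "\<dots> \<le> (5 * real CARD('n) * E (real CARD('n) + 1) (5/2)) / (E (real CARD('n)) 2 / 2)"
    using laplacian_angular_bound P E_pos[of "real CARD('n)" 2] by (intro frac_le) auto
  also have "E (real CARD('n) + 1) (5/2) = E 1 (1/2) * E (real CARD('n)) 2"
    unfolding log_power_mult by (simp add: add.commute)
  finally show ?thesis using E_pos[of "real CARD('n)" 2] by simp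
qed

lemma tangential_coeff_bound: "\<bar>tangential_coeff \<rho> x\<bar> \<le> 23 * real CARD('n)^2 * E 1 (1/2)"
proof -
  let ?A = "E (real CARD('n) - 1) (5/2)"
  let ?M = "?A + (x \<bullet> x) * Q"
  have A: "0 < ?A" by (rule E_pos)
  have e: "E (real CARD('n)) 3 = E 1 (1/2) * ?A" unfolding log_power_mult by simp
  have NN: "3 * real CARD('n) \<le> 3 * real CARD('n)^2" using N3 by (simp add: power2_eq_square)
  have "\<bar>radial_coeff \<rho> x * ?M\<bar> \<le> (10 * real CARD('n) * E 1 (1/2)) * (2 * real CARD('n) * ?A)"
    unfolding abs_mult using E_pos[of 1 "1/2"] by (intro mult_mono radial_coeff_bound angular_gradient_bound) auto
  also have "\<dots> = 20 * real CARD('n)^2 * (E 1 (1/2) * ?A)" by (simp add: power2_eq_square)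
  finally have t: "\<bar>radial_coeff \<rho> x * ?M\<bar> \<le> 20 * real CARD('n)^2 * (E 1 (1/2) * ?A)" .
  have "3 * real CARD('n) * (E 1 (1/2) * ?A) \<le> 3 * real CARD('n)^2 * (E 1 (1/2) * ?A)"
    using NN A E_pos[of 1 "1/2"] by (intro mult_right_mono) auto
  with laplacian_radial_bound have "\<bar>laplacian_radial \<rho> x\<bar> \<le> 3 * real CARD('n)^2 * (E 1 (1/2) * ?A)" unfolding e by linarith
  with t have num: "\<bar>- laplacian_radial \<rho> x - radial_coeff \<rho> x * ?M\<bar> \<le> 23 * real CARD('n)^2 * (E 1 (1/2) * ?A)" by linarith
  have den: "?A \<le> \<bar>(real CARD('n) - 1) * ?A\<bar>" using N3 A by (simp add: abs_mult)
  have "\<bar>tangential_coeff \<rho> x\<bar> = \<bar>- laplacian_radial \<rho> x - radial_coeff \<rho> x * ?M\<bar> / \<bar>(real CARD('n) - 1) * ?A\<bar>"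
    by (simp only: tangential_coeff_def abs_divide)
  also have "\<dots> \<le> (23 * real CARD('n)^2 * (E 1 (1/2) * ?A)) / ?A"
    using num den A by (intro frac_le) auto
  finally show ?thesis using A by simp
qed

lemma connection_entry_bound: "norm (connection_entry \<rho> a x) \<le> 56 * real CARD('n)^2 * E 1 (1/2)"
proof -
  have r: "x \<bullet> x > 0" using x0 by simp
  have "\<bar>x $ a\<bar> * norm x \<le> norm x * norm x"
    by (intro mult_right_mono) (auto simp: component_le_norm_cart)
  also have "\<dots> = x \<bullet> x" by (simp add: dot_square_norm power2_eq_square)
  finally have "\<bar>x $ a\<bar> * norm x / (x \<bullet> x) \<le> 1" using r by simp
  then have "\<bar>radial_coeff \<rho> x - tangential_coeff \<rho> x\<bar> * (\<bar>x $ a\<bar> * norm x / (x \<bullet> x)) \<le> \<bar>radial_coeff \<rho> x - tangential_coeff \<rho> x\<bar> * 1"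
    by (intro mult_left_mono) auto
  then have 1: "norm (((radial_coeff \<rho> x - tangential_coeff \<rho> x) / (x \<bullet> x) * x $ a) *\<^sub>R x) \<le> \<bar>radial_coeff \<rho> x - tangential_coeff \<rho> x\<bar>"
    using r by (simp add: abs_mult abs_divide)
  have "norm (connection_entry \<rho> a x) \<le> \<bar>tangential_coeff \<rho> x\<bar> + \<bar>radial_coeff \<rho> x - tangential_coeff \<rho> x\<bar>"
    unfolding connection_entry_def by (rule norm_triangle_le, rule add_mono[OF _ 1]) simp
  also have "\<dots> \<le> 2 * \<bar>tangential_coeff \<rho> x\<bar> + \<bar>radial_coeff \<rho> x\<bar>" by linarith
  also have "\<dots> \<le> 2 * (23 * real CARD('n)^2 * E 1 (1/2)) + 10 * real CARD('n) * E 1 (1/2)"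
    using tangential_coeff_bound radial_coeff_bound by linarith
  also have "10 * real CARD('n) * E 1 (1/2) \<le> 10 * real CARD('n)^2 * E 1 (1/2)"
    using N3 E_pos[of 1 "1/2"] by (intro mult_right_mono) (auto simp: power2_eq_square)
  finally show ?thesis by simp
qed

text \<open>The pairings with the two kinds of gradients that occur. The second one is arranged so that the sum over \<open>a\<close> turns
  \<open>(x $ a * x $ a) / (x \<bullet> x)\<close> into 1.\<close>

lemma connection_entry_inner:
  "connection_entry \<rho> a x \<bullet> x = radial_coeff \<rho> x * x $ a"
  "connection_entry \<rho> a x \<bullet> (c *\<^sub>R axis a 1 + (x $ a * d) *\<^sub>R x)
    = c * tangential_coeff \<rho> x + (x $ a * x $ a) / (x \<bullet> x) * (radial_coeff \<rho> x * (c + (x \<bullet> x) * d) - c * tangential_coeff \<rho> x)"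
proof -
  have r: "x \<bullet> x \<noteq> 0" using x0 by simp
  show 1: "connection_entry \<rho> a x \<bullet> x = radial_coeff \<rho> x * x $ a"
  proof -
    have "connection_entry \<rho> a x \<bullet> x = tangential_coeff \<rho> x * x $ a + (radial_coeff \<rho> x - tangential_coeff \<rho> x) / (x \<bullet> x) * x $ a * (x \<bullet> x)"
      by (simp add: connection_entry_def inner_add_left inner_axis')
    also have "\<dots> = tangential_coeff \<rho> x * x $ a + (radial_coeff \<rho> x - tangential_coeff \<rho> x) * x $ a"
      using x0 by simp
    finally show ?thesis by (simp add: algebra_simps)
  qed
  have 2: "connection_entry \<rho> a x \<bullet> axis a 1 = tangential_coeff \<rho> x + (radial_coeff \<rho> x - tangential_coeff \<rho> x) / (x \<bullet> x) * (x $ a * x $ a)"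
    unfolding connection_entry_def inner_add_left inner_scaleR_left by (simp add: inner_axis mult.assoc)
  show "connection_entry \<rho> a x \<bullet> (c *\<^sub>R axis a 1 + (x $ a * d) *\<^sub>R x)
    = c * tangential_coeff \<rho> x + (x $ a * x $ a) / (x \<bullet> x) * (radial_coeff \<rho> x * (c + (x \<bullet> x) * d) - c * tangential_coeff \<rho> x)"
    unfolding inner_add_right inner_scaleR_right 1 2 using r
    by (simp add: field_simps)
qed

end

text \<open>The pointwise system. At the origin both sides are 0 because all profiles vanish there by
  convention.\<close>

lemma form_dot_connection:
  fixes x :: "real^'n::finite" and s :: "'m::finite \<Rightarrow> 'n"
  assumes n: "CARD('n) \<ge> 3" and \<rho>: "\<rho> \<ge> 4" and x: "norm x < 1"
    and s: "bij_betw s (UNIV - {i0}) UNIV"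
  shows "form_dot (connection \<rho> i0 s x) (unbounded_map_grad \<rho> i0 s x) $ i
    = - (if i = i0 then laplacian_radial \<rho> x else x $ s i * laplacian_angular \<rho> x)"
proof (cases "x = 0")
  case True
  have "unbounded_map_grad \<rho> i0 s x = 0"
    by (simp add: True unbounded_map_grad_def log_power_slope_def vec_eq_iff)
  then show ?thesis
    by (simp add: form_dot_def True laplacian_radial_def laplacian_angular_def log_power_slope_def)
next
  case x0: False
  have \<rho>1: "\<rho> \<ge> 1" using \<rho> by simp
  note E_pos = log_power_pos[OF x \<rho>1 x0]
  let ?N = "real CARD('n)"
  let ?P = "log_power_slope \<rho> (?N - 2) 2 x" and ?Q = "log_power_slope \<rho> (?N - 1) (5/2) x"
  let ?A = "log_power \<rho> (?N - 1) (5/2) x"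
  have r: "x \<bullet> x \<noteq> 0" using x0 by simp
  have row0: "unbounded_map_grad \<rho> i0 s x $ i0 = ?P *\<^sub>R x"
    by (simp add: unbounded_map_grad_def vec_eq_iff)
  have row: "unbounded_map_grad \<rho> i0 s x $ k = ?A *\<^sub>R axis (s k) 1 + (x $ s k * ?Q) *\<^sub>R x" if "k \<noteq> i0" for k
    using that by (auto simp: unbounded_map_grad_def vec_eq_iff axis_def)
  show ?thesis
  proof (cases "i = i0")
    case True
    define g where "g a = connection_entry \<rho> a x \<bullet> (?A *\<^sub>R axis a 1 + (x $ a * ?Q) *\<^sub>R x)" for a
    define K where "K = radial_coeff \<rho> x * (?A + (x \<bullet> x) * ?Q) - ?A * tangential_coeff \<rho> x"
    have "form_dot (connection \<rho> i0 s x) (unbounded_map_grad \<rho> i0 s x) $ i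
        = (\<Sum>k\<in>UNIV. if k = i0 then 0 else g (s k))"
      unfolding form_dot_def True by (auto intro!: sum.cong simp: connection_def row g_def)
    also have "\<dots> = (\<Sum>k\<in>UNIV - {i0}. g (s k))"
      by (rule sum.mono_neutral_cong_right) auto
    also have "\<dots> = (\<Sum>a\<in>UNIV. g a)" by (rule sum.reindex_bij_betw[OF s])
    also have "\<dots> = (\<Sum>a\<in>UNIV. ?A * tangential_coeff \<rho> x + x $ a * x $ a * (K / (x \<bullet> x)))"
      unfolding g_def K_def connection_entry_inner(2)[OF n \<rho> x x0] by simp
    also have "\<dots> = ?N * (?A * tangential_coeff \<rho> x) + (x \<bullet> x) * (K / (x \<bullet> x))"
      unfolding sum.distrib sum_distrib_right[symmetric] by (simp add: inner_vec_def)
    also have "\<dots> = ?N * (?A * tangential_coeff \<rho> x) + K" using x0 by simp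
    \<comment> \<open>The form in which the definition of the tangential coefficient applies.\<close>
    also have "\<dots> = (?N - 1) * ?A * tangential_coeff \<rho> x + radial_coeff \<rho> x * (?A + (x \<bullet> x) * ?Q)"
      by (simp add: K_def algebra_simps)
    also have "(?N - 1) * ?A * tangential_coeff \<rho> x = - laplacian_radial \<rho> x - radial_coeff \<rho> x * (?A + (x \<bullet> x) * ?Q)"
      unfolding tangential_coeff_def using n E_pos[of "?N - 1" "5/2"] by simp
    finally show ?thesis using True by simp
  next
    case False
    have P: "?P \<noteq> 0" using radial_slope_lower_bound[OF n \<rho> x x0] E_pos[of ?N 2] by auto
    have "connection \<rho> i0 s x $ i $ k \<bullet> unbounded_map_grad \<rho> i0 s x $ k
        = (if k = i0 then - connection_entry \<rho> (s i) x \<bullet> (?P *\<^sub>R x) else 0)" for k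
      using False by (cases "k = i0") (simp_all add: connection_def row0)
    then have "form_dot (connection \<rho> i0 s x) (unbounded_map_grad \<rho> i0 s x) $ i
        = (\<Sum>k\<in>UNIV. if k = i0 then - connection_entry \<rho> (s i) x \<bullet> (?P *\<^sub>R x) else 0)"
      by (simp only: form_dot_def vec_lambda_beta)
    also have "\<dots> = - (?P * (radial_coeff \<rho> x * x $ s i))"
      by (simp add: connection_entry_inner(1)[OF n \<rho> x x0])
    also have "\<dots> = - (x $ s i * laplacian_angular \<rho> x)" using P by (simp add: radial_coeff_def)
    finally show ?thesis using False by simp
  qed
qed

lemma norm_vec_le_sum: "norm (y :: 'b::real_normed_vector^'k::finite) \<le> (\<Sum>i\<in>UNIV. norm (y $ i))"
  unfolding norm_vec_def by (rule L2_set_le_sum) simp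

lemma connection_bound:
  fixes x :: "real^'n::finite" and s :: "'m::finite \<Rightarrow> 'n"
  assumes "CARD('n) \<ge> 3" "\<rho> \<ge> 4" "norm x < 1" "x \<noteq> 0"
  shows "norm (connection \<rho> i0 s x) \<le> real (CARD('m))^2 * (56 * (real CARD('n))\<^sup>2) * log_power \<rho> 1 (1/2) x"
proof -
  let ?K = "56 * (real CARD('n))\<^sup>2 * log_power \<rho> 1 (1/2) x"
  have "norm (connection \<rho> i0 s x $ i $ k) \<le> ?K" for i k
    using connection_entry_bound[OF assms] by (auto simp: connection_def)
  then have "(\<Sum>i\<in>UNIV. \<Sum>k\<in>UNIV. norm (connection \<rho> i0 s x $ i $ k)) \<le> (\<Sum>i\<in>(UNIV::'m set). \<Sum>k\<in>(UNIV::'m set). ?K)"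
    by (intro sum_mono)
  moreover have "norm (connection \<rho> i0 s x) \<le> (\<Sum>i\<in>UNIV. \<Sum>k\<in>UNIV. norm (connection \<rho> i0 s x $ i $ k))"
    by (rule order_trans[OF norm_vec_le_sum sum_mono[OF norm_vec_le_sum]])
  ultimately show ?thesis by (simp add: power2_eq_square mult.assoc)
qed

section \<open>Integrability and unboundedness\<close>

lemma borel_measurable_vecI:
  fixes f :: "'a \<Rightarrow> 'b::euclidean_space^'k::finite"
  assumes "\<And>i. (\<lambda>x. f x $ i) \<in> borel_measurable M"
  shows "f \<in> borel_measurable M"
proof (subst borel_measurable_euclidean_space, rule ballI)
  fix b :: "'b^'k" assume "b \<in> Basis"
  then obtain i c where b: "b = axis i c" by (auto simp: Basis_vec_def)
  show "(\<lambda>x. f x \<bullet> b) \<in> borel_measurable M"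
    unfolding b inner_axis using assms[of i] by measurable
qed

lemma unbounded_map_measurable: "unbounded_map \<rho> i0 s \<in> borel_measurable borel"
proof (rule borel_measurable_vecI)
  show "(\<lambda>x. unbounded_map \<rho> i0 s x $ i) \<in> borel_measurable borel" for i
    by (cases "i = i0") (auto simp: unbounded_map_def intro!: borel_measurable_times log_power_measurable)
qed

lemma unbounded_map_grad_measurable: "unbounded_map_grad \<rho> i0 s \<in> borel_measurable borel"
proof (intro borel_measurable_vecI)
  show "(\<lambda>x. unbounded_map_grad \<rho> i0 s x $ i $ j) \<in> borel_measurable borel" for i j
    unfolding unbounded_map_grad_def vec_lambda_beta by measurable
qed

lemma connection_entry_measurable: "connection_entry \<rho> a \<in> borel_measurable borel"
  unfolding connection_entry_def[abs_def] tangential_coeff_def radial_coeff_def laplacian_radial_def laplacian_angular_def by measurable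

lemma connection_measurable: "connection \<rho> i0 s \<in> borel_measurable borel"
proof (intro borel_measurable_vecI[of "connection \<rho> i0 s"] borel_measurable_vecI[of "\<lambda>x. connection \<rho> i0 s x $ i" for i])
  show "(\<lambda>x. connection \<rho> i0 s x $ i $ k) \<in> borel_measurable borel" for i k
    by (cases "i = i0"; cases "k = i0") (auto simp: connection_def intro!: borel_measurable_uminus connection_entry_measurable)
qed

lemma Lp_of_log_power_bound:
  fixes f :: "real^'n::finite \<Rightarrow> 'b::euclidean_space"
  assumes f: "f \<in> borel_measurable borel" and \<rho>: "\<rho> \<ge> 1" and C: "C \<ge> 0" and p: "p > 0"
    and ap: "a * p = real CARD('n)" and bp: "b * p > 1"
    and le: "\<And>x. norm x < 1 \<Longrightarrow> x \<noteq> 0 \<Longrightarrow> norm (f x) \<le> C * log_power \<rho> a b x"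
  shows "f \<in> Lp_space p (ball 0 1)"
    and "(LINT x|lebesgue_on (ball 0 1). norm (f x) powr p)
      \<le> C powr p * (LINT x|lebesgue_on (ball 0 1). log_power \<rho> (real CARD('n)) (b * p) (x :: real^'n))"
proof -
  have bd: "norm (f x) powr p \<le> C powr p * log_power \<rho> (real CARD('n)) (b * p) x"
    if "norm x < 1" "x \<noteq> 0" for x
  proof -
    have "norm (f x) powr p \<le> (C * log_power \<rho> a b x) powr p"
      using le[OF that] p by (intro powr_mono2) auto
    also have "\<dots> = C powr p * log_power \<rho> (real CARD('n)) (b * p) x"
      using C by (simp add: powr_mult log_power_powr ap)
    finally show ?thesis .
  qed
  have m: "(\<lambda>x. norm (f x) powr p) \<in> borel_measurable borel" using f by measurable
  have int: "integrable (lebesgue_on (ball 0 1)) (\<lambda>x. norm (f x) powr p)"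
    by (rule integrable_of_log_power_bound[OF m \<rho> bp]) (use bd in auto)
  then show "f \<in> Lp_space p (ball 0 1)"
    using borel_imp_lebesgue_on[OF f] by (simp add: Lp_space_def)
  have int': "integrable (lebesgue_on (ball 0 1)) (log_power \<rho> (real CARD('n)) (b * p) :: real^'n \<Rightarrow> real)"
    by (rule integrable_of_log_power_bound[where C = 1, OF log_power_measurable(1) \<rho> bp]) simp
  have "(LINT x|lebesgue_on (ball 0 1). norm (f x) powr p)
     \<le> (LINT x|lebesgue_on (ball 0 1). C powr p * log_power \<rho> (real CARD('n)) (b * p) (x :: real^'n))"
  proof (rule integral_mono_AE[OF int])
    show "integrable (lebesgue_on (ball 0 1)) (\<lambda>x::real^'n. C powr p * log_power \<rho> (real CARD('n)) (b * p) x)"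
      using int' by simp
    have "AE x in lebesgue_on (ball 0 1). x \<noteq> (0::real^'n)" by (rule AE_lebesgue_on_neq) simp
    moreover have "AE x in lebesgue_on (ball 0 1). norm (x::real^'n) < 1"
      by (rule AE_I2) (simp add: space_restrict_space)
    ultimately show "AE x in lebesgue_on (ball 0 1).
        norm (f x) powr p \<le> C powr p * log_power \<rho> (real CARD('n)) (b * p) x"
      by eventually_elim (rule bd)
  qed
  then show "(LINT x|lebesgue_on (ball 0 1). norm (f x) powr p)
      \<le> C powr p * (LINT x|lebesgue_on (ball 0 1). log_power \<rho> (real CARD('n)) (b * p) (x :: real^'n))"
    by simp
qed

text \<open>Of the exponent \<open>3/2\<close> of the logarithm, \<open>5/4 > 1\<close> suffices for integrability, and the remaining \<open>1/4\<close>
  becomes decay in \<open>\<rho>\<close>.\<close>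

lemma integral_log_power_decay:
  assumes \<rho>: "\<rho> \<ge> 1" and q: "q \<ge> 3/2"
  shows "(LINT x|lebesgue_on (ball 0 1). log_power \<rho> (real CARD('n)) q (x :: real^'n::finite))
    \<le> \<rho> powr (- 1/4) * (LINT x|lebesgue_on (ball 0 1). log_power 1 (real CARD('n)) (5/4) (x :: real^'n))"
proof -
  have "(LINT x|lebesgue_on (ball 0 1). log_power \<rho> (real CARD('n)) q (x :: real^'n))
    \<le> (LINT x|lebesgue_on (ball 0 1). \<rho> powr (- 1/4) * log_power 1 (real CARD('n)) (5/4) (x :: real^'n))"
  proof (rule integral_mono)
    show "integrable (lebesgue_on (ball 0 1)) (log_power \<rho> (real CARD('n)) q :: real^'n \<Rightarrow> real)"
      by (rule integrable_of_log_power_bound[where C = 1 and q = q, OF log_power_measurable(1) \<rho>]) (use q in auto)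
    show "integrable (lebesgue_on (ball 0 1)) (\<lambda>x::real^'n. \<rho> powr (- 1/4) * log_power 1 (real CARD('n)) (5/4) x)"
      using integrable_log_power[of "5/4", where 'n = 'n] by simp
    fix x :: "real^'n" assume "x \<in> space (lebesgue_on (ball 0 1))"
    then have x: "norm x < 1" by (simp add: space_restrict_space)
    have "log_power \<rho> (real CARD('n)) q x \<le> log_power \<rho> (real CARD('n)) (5/4 + 1/4) x"
      by (rule log_power_mono[OF x \<rho>]) (use q in auto)
    also have "\<dots> \<le> \<rho> powr (- 1/4) * log_power \<rho> (real CARD('n)) (5/4) x"
      using log_power_le_scaled[OF x \<rho>, of "1/4" _ "5/4"] by simp
    also have "\<dots> \<le> \<rho> powr (- 1/4) * log_power 1 (real CARD('n)) (5/4) x"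
      by (intro mult_left_mono log_power_le_shift_1 x \<rho>) auto
    finally show "log_power \<rho> (real CARD('n)) q x \<le> \<rho> powr (- 1/4) * log_power 1 (real CARD('n)) (5/4) x" .
  qed
  then show ?thesis by simp
qed

lemma integrable_imp_locally_integrable:
  fixes f :: "real^'n::finite \<Rightarrow> 'b::euclidean_space"
  assumes "integrable (lebesgue_on U) f" "U \<in> sets lebesgue"
  shows "f locally_integrable_on U"
  unfolding locally_integrable_on_def
proof (intro allI impI)
  fix K assume K: "compact K \<and> K \<subseteq> U"
  then have Km: "K \<in> sets lebesgue" by (simp add: borel_compact)
  have "set_integrable lebesgue U f"
    using assms by (simp add: set_integrable_eq)
  then have "set_integrable lebesgue K f"
    by (rule set_integrable_subset) (use K Km in auto)
  then show "integrable (lebesgue_on K) f" using Km by (simp add: set_integrable_eq)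
qed

lemma not_ess_bounded_onI:
  fixes u :: "real^'n::finite \<Rightarrow> 'b::real_normed_vector"
  assumes lim: "filterlim (\<lambda>x. norm (u x)) at_top (at 0)" and V: "open V" "0 \<in> V"
  shows "\<not> ess_bounded_on u V"
proof
  assume "ess_bounded_on u V"
  then obtain C where C: "AE x in lebesgue_on V. norm (u x) \<le> C" by (auto simp: ess_bounded_on_def)
  have "\<forall>\<^sub>F x in at 0. C < norm (u x)" using lim by (simp add: filterlim_at_top_dense)
  then obtain d where d: "d > 0" "\<And>x. x \<noteq> 0 \<Longrightarrow> dist x 0 < d \<Longrightarrow> C < norm (u x)"
    by (auto simp: eventually_at)
  obtain e where e: "e > 0" "ball 0 e \<subseteq> V" using V openE by blast
  define B where "B = ball (0::real^'n) (min d e)"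
  have "AE x in lebesgue. x \<in> V \<longrightarrow> norm (u x) \<le> C"
    using C V by (subst (asm) AE_restrict_space_iff) auto
  moreover have "AE x in lebesgue. x \<noteq> (0::real^'n)" by (rule AE_completion[OF AE_lborel_singleton])
  ultimately have "AE x in lebesgue. x \<notin> B"
  proof eventually_elim
    case (elim x)
    show ?case
    proof
      assume "x \<in> B"
      then have "x \<in> V" "dist x 0 < d" using e by (auto simp: B_def)
      then show False using elim d(2)[of x] by auto
    qed
  qed
  then obtain M where M: "M \<in> null_sets lebesgue" "B \<subseteq> M"
    unfolding eventually_ae_filter by auto
  then have "negligible B" using negligible_iff_null_sets negligible_subset by blast
  moreover have "open B" "B \<noteq> {}" using d e by (auto simp: B_def)
  ultimately show False using open_not_negligible by blast
qed

text \<open>A continuous representative would be bounded near 0, and hence \<open>u\<close> would be essentially bounded there.\<close>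

lemma no_continuous_representativeI:
  fixes u :: "real^'n::finite \<Rightarrow> 'b::real_normed_vector"
  assumes U: "open U" "0 \<in> U"
    and unb: "\<And>V. open V \<Longrightarrow> 0 \<in> V \<Longrightarrow> V \<subseteq> U \<Longrightarrow> \<not> ess_bounded_on u V"
  shows "\<not> has_continuous_representative u U"
proof
  assume "has_continuous_representative u U"
  then obtain v where v: "continuous_on U v" "AE x in lebesgue_on U. v x = u x"
    by (auto simp: has_continuous_representative_def)
  define V where "V = U \<inter> v -` ball (v 0) 1"
  have V: "open V" "0 \<in> V" "V \<subseteq> U"
    using U continuous_open_preimage[OF v(1) U(1) open_ball] by (auto simp: V_def)
  have "AE x in lebesgue. x \<in> U \<longrightarrow> v x = u x"
    using v(2) U by (subst (asm) AE_restrict_space_iff) auto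
  then have "AE x in lebesgue. x \<in> V \<longrightarrow> norm (u x) \<le> norm (v 0) + 1"
  proof eventually_elim
    case (elim x)
    show ?case
    proof
      assume x: "x \<in> V"
      then have "dist (v 0) (v x) < 1" "v x = u x" using elim by (auto simp: V_def)
      then show "norm (u x) \<le> norm (v 0) + 1"
        using norm_triangle_ineq2[of "u x" "v 0"] by (simp add: dist_norm norm_minus_commute)
    qed
  qed
  then have "AE x in lebesgue_on V. norm (u x) \<le> norm (v 0) + 1"
    using V(1) by (subst AE_restrict_space_iff) auto
  then have "ess_bounded_on u V" by (auto simp: ess_bounded_on_def)
  then show False using unb V by blast
qed

lemma unbounded_map_norm_at_top:
  fixes s :: "'m::finite \<Rightarrow> 'n::finite"
  assumes "CARD('n) \<ge> 3"
  shows "filterlim (\<lambda>x. norm (unbounded_map \<rho> i0 s x)) at_top (at 0)"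
proof -
  define k where "k = real CARD('n) - 2"
  have k: "k > 0" using assms by (simp add: k_def)
  have "filterlim (\<lambda>r. r powr (- k) * (\<rho> - ln r) powr (- 2)) at_top (at_right 0)"
    using k by real_asymp
  moreover have "filterlim norm (at_right 0) (at (0 :: real^'n))"
    unfolding filterlim_at using tendsto_norm[OF tendsto_ident_at, of "0::real^'n" UNIV]
    by (auto simp: eventually_at_filter)
  ultimately have "filterlim (\<lambda>x::real^'n. norm x powr (- k) * (\<rho> - ln (norm x)) powr (- 2)) at_top (at 0)"
    by (rule filterlim_compose)
  then show ?thesis
  proof (rule filterlim_at_top_mono)
    have "norm x powr (- k) * (\<rho> - ln (norm x)) powr (- 2) \<le> norm (unbounded_map \<rho> i0 s x)" for x :: "real^'n"
      using component_le_norm_cart[of "unbounded_map \<rho> i0 s x" i0]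
      by (simp add: unbounded_map_def log_power_def k_def abs_mult)
    then show "\<forall>\<^sub>F x in at (0::real^'n). norm x powr (- k) * (\<rho> - ln (norm x)) powr (- 2) \<le> norm (unbounded_map \<rho> i0 s x)"
      by simp
  qed
qed

section \<open>The counterexample\<close>

lemma unbounded_map_bounds:
  fixes x :: "real^'n::finite" and s :: "'m::finite \<Rightarrow> 'n"
  assumes n: "CARD('n) \<ge> 3" and \<rho>: "\<rho> \<ge> 1" and x: "norm x < 1"
  shows "norm (unbounded_map \<rho> i0 s x) \<le> real CARD('m) * log_power \<rho> (real CARD('n) - 1) 2 x"
    and "norm (unbounded_map_grad \<rho> i0 s x)
      \<le> real CARD('m) * (real CARD('n) * (real CARD('n) + 3)) * log_power \<rho> (real CARD('n) - 1) 2 x"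
proof -
  let ?N = "real CARD('n)"
  let ?E = "log_power \<rho> (?N - 1) 2 x"
  have N: "?N \<ge> 3" using n by simp
  have "\<bar>x $ s i * log_power \<rho> (?N - 1) (5/2) x\<bar> \<le> 1 * log_power \<rho> (?N - 2) (5/2) x" for i
    by (rule component_mult_log_power_bound) (simp add: algebra_simps)
  moreover have "1 * log_power \<rho> (?N - 2) (5/2) x \<le> ?E" "log_power \<rho> (?N - 2) 2 x \<le> ?E"
    using log_power_mono[OF x \<rho>] by simp_all
  ultimately have "norm (unbounded_map \<rho> i0 s x $ i) \<le> ?E" for i
    by (auto simp: unbounded_map_def intro: order_trans)
  then have "(\<Sum>i\<in>UNIV. norm (unbounded_map \<rho> i0 s x $ i)) \<le> (\<Sum>i\<in>(UNIV::'m set). ?E)" by (intro sum_mono)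
  then show "norm (unbounded_map \<rho> i0 s x) \<le> real CARD('m) * ?E"
    using norm_vec_le_sum[of "unbounded_map \<rho> i0 s x"] by simp
  have entry: "norm (unbounded_map_grad \<rho> i0 s x $ i $ j) \<le> (?N + 3) * ?E" for i j
  proof (cases "i = i0")
    case True
    have "\<bar>x $ j * log_power_slope \<rho> (?N - 2) 2 x\<bar> \<le> (\<bar>?N - 2\<bar> + \<bar>2\<bar>) * log_power \<rho> (?N - 2 + 1) 2 x"
      using \<rho> x by (intro slope_bounds) auto
    also have "\<dots> \<le> (?N + 3) * ?E" using N by (intro mult_mono) auto
    finally show ?thesis using True by (simp add: unbounded_map_grad_def)
  next
    case False
    let ?A = "log_power \<rho> (?N - 1) (5/2) x"
    have "norm (unbounded_map_grad \<rho> i0 s x $ i $ j) \<le> \<bar>if s i = j then ?A else 0\<bar>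
        + \<bar>x $ s i * (x $ j * log_power_slope \<rho> (?N - 1) (5/2) x)\<bar>"
      using False by (simp only: unbounded_map_grad_def vec_lambda_beta if_False real_norm_def abs_triangle_ineq)
    also have "\<dots> \<le> 1 * ?A + (\<bar>?N - 1\<bar> + \<bar>5/2\<bar>) * ?A"
      using \<rho> x by (intro add_mono slope_bounds) auto
    also have "\<dots> = (?N + 5/2) * ?A" using N by (simp add: algebra_simps)
    also have "\<dots> \<le> (?N + 3) * ?E"
      using N by (intro mult_mono log_power_mono[OF x \<rho>]) auto
    finally show ?thesis .
  qed
  have "(\<Sum>i\<in>UNIV. \<Sum>j\<in>UNIV. norm (unbounded_map_grad \<rho> i0 s x $ i $ j)) \<le> (\<Sum>i\<in>(UNIV::'m set). \<Sum>j\<in>(UNIV::'n set). (?N + 3) * ?E)"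
    by (intro sum_mono entry)
  moreover have "norm (unbounded_map_grad \<rho> i0 s x) \<le> (\<Sum>i\<in>UNIV. \<Sum>j\<in>UNIV. norm (unbounded_map_grad \<rho> i0 s x $ i $ j))"
    by (rule order_trans[OF norm_vec_le_sum sum_mono[OF norm_vec_le_sum]])
  ultimately show "norm (unbounded_map_grad \<rho> i0 s x) \<le> real CARD('m) * (?N * (?N + 3)) * ?E"
    by (simp add: mult.assoc)
qed

lemma has_weak_gradient_unbounded_map:
  fixes s :: "'m::finite \<Rightarrow> 'n::finite"
  assumes n: "CARD('n) \<ge> 3" and \<rho>: "\<rho> \<ge> 1"
  shows "has_weak_gradient (unbounded_map \<rho> i0 s) (unbounded_map_grad \<rho> i0 s) (ball 0 1)"
proof -
  let ?N = "real CARD('n)"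
  have le: "c * log_power \<rho> (?N - 1) 2 x \<le> c * log_power \<rho> ?N 2 x" if "norm x < 1" "c \<ge> 0" for x :: "real^'n" and c
    by (intro mult_left_mono log_power_mono that \<rho>) auto
  have "integrable (lebesgue_on (ball 0 1)) (unbounded_map \<rho> i0 s)"
  proof (rule integrable_of_log_power_bound[OF unbounded_map_measurable \<rho>, of 2])
    show "norm (unbounded_map \<rho> i0 s x) \<le> real CARD('m) * log_power \<rho> ?N 2 x" if "norm x < 1" for x
      using unbounded_map_bounds(1)[OF n \<rho> that] le[OF that] by (meson of_nat_0_le_iff order_trans)
  qed simp
  moreover have "integrable (lebesgue_on (ball 0 1)) (unbounded_map_grad \<rho> i0 s)"
  proof (rule integrable_of_log_power_bound[OF unbounded_map_grad_measurable \<rho>, of 2])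
    show "norm (unbounded_map_grad \<rho> i0 s x) \<le> real CARD('m) * (?N * (?N + 3)) * log_power \<rho> ?N 2 x" if "norm x < 1" for x
      by (rule order_trans[OF unbounded_map_bounds(2)[OF n \<rho> that] le[OF that]]) simp
  qed simp
  moreover have "distr_partial j (regular_distr (ball 0 1) (\<lambda>x. unbounded_map \<rho> i0 s x $ i)) \<phi>
      = regular_distr (ball 0 1) (\<lambda>x. unbounded_map_grad \<rho> i0 s x $ i $ j) \<phi>"
    if "\<phi> \<in> test_functions (ball 0 1)" for i j \<phi>
    using distr_log_power(1)[OF \<rho> _ _ that, of 2 "?N - 2" j]
      distr_component_log_power(1)[OF \<rho> _ _ that, of "5/2" "?N - 1" j "s i"]
    by (cases "i = i0") (simp_all add: unbounded_map_def unbounded_map_grad_def)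
  ultimately show ?thesis
    unfolding has_weak_gradient_def by (auto intro: integrable_imp_locally_integrable)
qed

lemma unbounded_map_equation:
  fixes s :: "'m::finite \<Rightarrow> 'n::finite"
  assumes n: "CARD('n) \<ge> 3" and \<rho>: "\<rho> \<ge> 4" and s: "bij_betw s (UNIV - {i0}) UNIV"
    and \<phi>: "\<phi> \<in> test_functions (ball 0 1)"
  shows "- distr_laplacian (regular_distr (ball 0 1) (\<lambda>x. unbounded_map \<rho> i0 s x $ i)) \<phi>
    = regular_distr (ball 0 1) (\<lambda>x. form_dot (connection \<rho> i0 s x) (unbounded_map_grad \<rho> i0 s x) $ i) \<phi>"
proof -
  let ?N = "real CARD('n)"
  have \<rho>1: "\<rho> \<ge> 1" using \<rho> by simp
  have "distr_laplacian (regular_distr (ball 0 1) (\<lambda>x. unbounded_map \<rho> i0 s x $ i)) \<phi>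
      = regular_distr (ball 0 1) (\<lambda>x. if i = i0 then laplacian_radial \<rho> x else x $ s i * laplacian_angular \<rho> x) \<phi>"
    using distr_log_power(2)[OF \<rho>1 _ _ \<phi>, of 2 "?N - 2"]
      distr_component_log_power(2)[OF \<rho>1 _ _ \<phi>, of "5/2" "?N - 1" "s i"]
    by (cases "i = i0") (simp_all add: unbounded_map_def laplacian_radial_def laplacian_angular_def)
  moreover have "regular_distr (ball 0 1) (\<lambda>x. form_dot (connection \<rho> i0 s x) (unbounded_map_grad \<rho> i0 s x) $ i) \<phi>
      = (LINT x|lebesgue_on (ball 0 1). - ((if i = i0 then laplacian_radial \<rho> x else x $ s i * laplacian_angular \<rho> x) * \<phi> x))"
    unfolding regular_distr_def
  proof (rule Bochner_Integration.integral_cong[OF refl])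
    fix x :: "real^'n" assume "x \<in> space (lebesgue_on (ball 0 1))"
    then have "norm x < 1" by (simp add: space_restrict_space)
    from form_dot_connection[OF n \<rho> this s]
    show "form_dot (connection \<rho> i0 s x) (unbounded_map_grad \<rho> i0 s x) $ i * \<phi> x
      = - ((if i = i0 then laplacian_radial \<rho> x else x $ s i * laplacian_angular \<rho> x) * \<phi> x)" by simp
  qed
  ultimately show ?thesis by (simp add: regular_distr_def)
qed

text \<open>The bound for \<open>|\<Omega>| powr n\<close> carries the logarithm with exponent \<open>n / 2\<close>, which is at least \<open>3/2\<close> in the dimensions
  considered; in dimension 2 it would be 1, and the bound would fail to be integrable.\<close>

lemma Lp_norm_connection_small:
  assumes "CARD('n::finite) \<ge> 3" and "\<epsilon> > 0"
  shows "\<exists>\<rho>\<ge>4. \<forall>(i0::'m::finite) (s :: 'm \<Rightarrow> 'n).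
    connection \<rho> i0 s \<in> Lp_space (real CARD('n)) (ball 0 1) \<and>
    Lp_norm (real CARD('n)) (ball 0 1) (connection \<rho> i0 s) < \<epsilon>"
proof -
  let ?N = "real CARD('n)"
  have N: "?N \<ge> 3" using assms by simp
  define K where "K = real (CARD('m))^2 * (56 * ?N\<^sup>2)"
  define I where "I = (LINT x|lebesgue_on (ball 0 1). log_power 1 ?N (5/4) (x :: real^'n))"
  have K: "K \<ge> 0" by (simp add: K_def)
  have "((\<lambda>\<rho>::real. K powr ?N * (\<rho> powr (- 1/4) * I)) \<longlongrightarrow> K powr ?N * (0 * I)) at_top"
    by (intro tendsto_intros) real_asymp
  then have "\<forall>\<^sub>F \<rho> in at_top. K powr ?N * (\<rho> powr (- 1/4) * I) < \<epsilon> powr ?N"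
    using assms(2) by (intro order_tendstoD(2)) auto
  then have "\<forall>\<^sub>F \<rho> in at_top. K powr ?N * (\<rho> powr (- 1/4) * I) < \<epsilon> powr ?N \<and> 4 \<le> \<rho>"
    using eventually_ge_at_top[of 4] by eventually_elim simp
  then obtain \<rho> where \<rho>: "\<rho> \<ge> 4" "K powr ?N * (\<rho> powr (- 1/4) * I) < \<epsilon> powr ?N"
    using eventually_happens[of _ "at_top :: real filter"] by auto
  show ?thesis
  proof (intro exI[of _ \<rho>] conjI allI \<rho>(1))
    fix i0 :: 'm and s :: "'m \<Rightarrow> 'n"
    have bd: "norm (connection \<rho> i0 s x) \<le> K * log_power \<rho> 1 (1/2) x" if "norm x < 1" "x \<noteq> 0" for x
      unfolding K_def by (rule connection_bound[OF assms(1) \<rho>(1) that])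
    have \<rho>1: "\<rho> \<ge> 1" and exps: "?N > 0" "1 * ?N = ?N" "1/2 * ?N > 1" "1/2 * ?N \<ge> 3/2"
      using \<rho> N by auto
    note L = Lp_of_log_power_bound[OF connection_measurable \<rho>1 K exps(1,2,3) bd]
    show "connection \<rho> i0 s \<in> Lp_space ?N (ball 0 1)" by (rule L(1))
    let ?J = "LINT x|lebesgue_on (ball 0 1). norm (connection \<rho> i0 s x) powr ?N"
    have "?J \<le> K powr ?N * (LINT x|lebesgue_on (ball 0 1). log_power \<rho> ?N (1/2 * ?N) (x :: real^'n))"
      by (rule L(2))
    also have "\<dots> \<le> K powr ?N * (\<rho> powr (- 1/4) * I)"
      unfolding I_def by (intro mult_left_mono integral_log_power_decay \<rho>1 exps(4)) simp
    also have "\<dots> < \<epsilon> powr ?N" by (rule \<rho>(2))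
    finally have "?J powr (1 / ?N) < (\<epsilon> powr ?N) powr (1 / ?N)"
      using N by (intro powr_less_mono2) auto
    also have "\<dots> = \<epsilon>" using assms(2) N by (simp add: powr_powr)
    finally show "Lp_norm ?N (ball 0 1) (connection \<rho> i0 s) < \<epsilon>" by (simp add: Lp_norm_def)
  qed
qed

theorem proposition6p1:
  fixes \<epsilon>\<^sub>0 :: real
  assumes "CARD('n::finite) \<ge> 3"
    and "CARD('m::finite) = CARD('n) + 1"
    and "\<epsilon>\<^sub>0 > 0"
  shows "\<exists>(u :: real^'n \<Rightarrow> real^'m) (Du :: real^'n \<Rightarrow> real^'n^'m) (\<Omega> :: real^'n \<Rightarrow> real^'n^'m^'m).
     u \<in> W1p_space (real CARD('n) / (real CARD('n) - 1)) (ball 0 1) \<and>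
     has_weak_gradient u Du (ball 0 1) \<and>
     \<Omega> \<in> Lp_space (real CARD('n)) (ball 0 1) \<and>
     (\<forall>x\<in>ball 0 1. so_form (\<Omega> x)) \<and>
     Lp_norm (real CARD('n)) (ball 0 1) \<Omega> < \<epsilon>\<^sub>0 \<and>
     (\<forall>i. \<forall>\<phi>\<in>test_functions (ball 0 1).
        - distr_laplacian (regular_distr (ball 0 1) (\<lambda>x. u x $ i)) \<phi>
          = regular_distr (ball 0 1) (\<lambda>x. form_dot (\<Omega> x) (Du x) $ i) \<phi>) \<and>
     (\<forall>V. open V \<and> 0 \<in> V \<and> V \<subseteq> ball 0 1 \<longrightarrow> \<not> ess_bounded_on u V) \<and>
     \<not> has_continuous_representative u (ball 0 1)"
proof -
  let ?N = "real CARD('n)"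
  define p where "p = ?N / (?N - 1)"
  have N: "?N \<ge> 3" using assms(1) by simp
  \<comment> \<open>Any index may play the part of 0; the others are as many as the coordinates.\<close>
  obtain i0 :: 'm where True by simp
  have "card (UNIV - {i0}) = card (UNIV :: 'n set)" using assms(2) by (simp add: card_Diff_singleton)
  then obtain s where s: "bij_betw s (UNIV - {i0}) (UNIV :: 'n set)"
    using finite_same_card_bij[of "UNIV - {i0}" "UNIV :: 'n set"] by auto
  obtain \<rho> where \<rho>: "\<rho> \<ge> 4"
    and \<Omega>: "connection \<rho> i0 s \<in> Lp_space ?N (ball 0 1)" "Lp_norm ?N (ball 0 1) (connection \<rho> i0 s) < \<epsilon>\<^sub>0"
    using Lp_norm_connection_small[OF assms(1,3), where 'm = 'm] by blast
  have \<rho>1: "\<rho> \<ge> 1" using \<rho> by simp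
  \<comment> \<open>The map and its gradient are bounded by \<open>E (n - 1) 2\<close>, whose \<open>p\<close>-th power is \<open>E n (2 * p)\<close>.\<close>
  have p: "p > 0" "(?N - 1) * p = ?N" "2 * p > 1" using N by (auto simp: p_def field_simps)
  have grad: "has_weak_gradient (unbounded_map \<rho> i0 s) (unbounded_map_grad \<rho> i0 s) (ball 0 1)"
    by (rule has_weak_gradient_unbounded_map[OF assms(1) \<rho>1])
  have "unbounded_map \<rho> i0 s \<in> Lp_space p (ball 0 1)"
    by (rule Lp_of_log_power_bound(1)[OF unbounded_map_measurable \<rho>1 _ p unbounded_map_bounds(1)[OF assms(1) \<rho>1]]) auto
  moreover have "unbounded_map_grad \<rho> i0 s \<in> Lp_space p (ball 0 1)"
    by (rule Lp_of_log_power_bound(1)[OF unbounded_map_grad_measurable \<rho>1 _ p unbounded_map_bounds(2)[OF assms(1) \<rho>1]]) auto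
  ultimately have W: "unbounded_map \<rho> i0 s \<in> W1p_space p (ball 0 1)"
    using grad by (auto simp: W1p_space_def)
  have unb: "\<not> ess_bounded_on (unbounded_map \<rho> i0 s) V" if "open V" "0 \<in> V" for V
    by (rule not_ess_bounded_onI[OF unbounded_map_norm_at_top[OF assms(1)] that])
  have cont: "\<not> has_continuous_representative (unbounded_map \<rho> i0 s) (ball 0 1)"
    by (rule no_continuous_representativeI) (use unb in auto)
  show ?thesis
    using W grad \<Omega> so_form_connection[of \<rho> i0 s] unbounded_map_equation[OF assms(1) \<rho> s] unb cont
    unfolding p_def
    by (intro exI[of _ "unbounded_map \<rho> i0 s"] exI[of _ "unbounded_map_grad \<rho> i0 s"] exI[of _ "connection \<rho> i0 s"] conjI) auto
qed

end
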